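(* For every integer $k$ with $3\leq k\leq 8$, the complex group algebras of $\mathrm{SL}_2(\mathbb{F}_2[t]/(t^k))$ and $\mathrm{SL}_2(\mathbb{Z}/2^k\mathbb{Z})$ are not isomorphic: $\mathbb{C}[\mathrm{SL}_2(\mathbb{F}_2[t]/(t^k))]\not\cong\mathbb{C}[\mathrm{SL}_2(\mathbb{Z}/2^k\mathbb{Z})]$.
   Context: For a finite group $G$, $\mathbb{C}[G]$ denotes its complex group algebra; isomorphism means isomorphism of $\mathbb{C}$-algebras. For a commutative ring $R$, $\mathrm{SL}_2(R)$ is the group of $2\times 2$ matrices over $R$ with determinant $1$; $\mathbb{F}_2$ is the field with $2$ elements. *)

theory Defs
  imports Complex_Main "HOL-Algebra.Algebra" "HOL-Number_Theory.Residues"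
begin

text \<open>
  The tuple \<open>(a, b, c, d)\<close> stands for the matrix with first row \<open>(a, b)\<close> and second
  row \<open>(c, d)\<close>.
\<close>

definition SL2 :: "('a, 'm) ring_scheme \<Rightarrow> ('a \<times> 'a \<times> 'a \<times> 'a) monoid" where
  "SL2 R = \<lparr>
     carrier = {(a, b, c, d). a \<in> carrier R \<and> b \<in> carrier R \<and> c \<in> carrier R \<and> d \<in> carrier R \<and>
                  a \<otimes>\<^bsub>R\<^esub> d \<ominus>\<^bsub>R\<^esub> b \<otimes>\<^bsub>R\<^esub> c = \<one>\<^bsub>R\<^esub>},
     monoid.mult = (\<lambda>(a, b, c, d) (a', b', c', d').
                     (a \<otimes>\<^bsub>R\<^esub> a' \<oplus>\<^bsub>R\<^esub> b \<otimes>\<^bsub>R\<^esub> c', a \<otimes>\<^bsub>R\<^esub> b' \<oplus>\<^bsub>R\<^esub> b \<otimes>\<^bsub>R\<^esub> d',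
                      c \<otimes>\<^bsub>R\<^esub> a' \<oplus>\<^bsub>R\<^esub> d \<otimes>\<^bsub>R\<^esub> c', c \<otimes>\<^bsub>R\<^esub> b' \<oplus>\<^bsub>R\<^esub> d \<otimes>\<^bsub>R\<^esub> d')),
     one = (\<one>\<^bsub>R\<^esub>, \<zero>\<^bsub>R\<^esub>, \<zero>\<^bsub>R\<^esub>, \<one>\<^bsub>R\<^esub>)\<rparr>"

lemma (in cring) SL2_group: "group (SL2 R)"
proof (rule groupI)
  fix x y assume x: "x \<in> carrier (SL2 R)" and y: "y \<in> carrier (SL2 R)"
  obtain a b c d where xe: "x = (a, b, c, d)" by (cases x)
  obtain a' b' c' d' where ye: "y = (a', b', c', d')" by (cases y)
  have cl: "a \<in> carrier R" "b \<in> carrier R" "c \<in> carrier R" "d \<in> carrier R"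
    "a' \<in> carrier R" "b' \<in> carrier R" "c' \<in> carrier R" "d' \<in> carrier R"
    and det: "a \<otimes> d \<ominus> b \<otimes> c = \<one>" "a' \<otimes> d' \<ominus> b' \<otimes> c' = \<one>"
    using x y by (auto simp: SL2_def xe ye)
  have "(a \<otimes> a' \<oplus> b \<otimes> c') \<otimes> (c \<otimes> b' \<oplus> d \<otimes> d') \<ominus> (a \<otimes> b' \<oplus> b \<otimes> d') \<otimes> (c \<otimes> a' \<oplus> d \<otimes> c')
      = (a \<otimes> d \<ominus> b \<otimes> c) \<otimes> (a' \<otimes> d' \<ominus> b' \<otimes> c')"
    using cl by algebra
  then show "x \<otimes>\<^bsub>SL2 R\<^esub> y \<in> carrier (SL2 R)"
    using cl det by (simp add: SL2_def xe ye)
next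
  show "\<one>\<^bsub>SL2 R\<^esub> \<in> carrier (SL2 R)"
    by (simp add: SL2_def) algebra
next
  fix x y z assume "x \<in> carrier (SL2 R)" "y \<in> carrier (SL2 R)" "z \<in> carrier (SL2 R)"
  then show "x \<otimes>\<^bsub>SL2 R\<^esub> y \<otimes>\<^bsub>SL2 R\<^esub> z = x \<otimes>\<^bsub>SL2 R\<^esub> (y \<otimes>\<^bsub>SL2 R\<^esub> z)"
    by (cases x; cases y; cases z) (auto simp: SL2_def l_distr r_distr m_assoc a_ac)
next
  fix x assume "x \<in> carrier (SL2 R)"
  then show "\<one>\<^bsub>SL2 R\<^esub> \<otimes>\<^bsub>SL2 R\<^esub> x = x"
    by (cases x) (auto simp: SL2_def)
next
  fix x assume x: "x \<in> carrier (SL2 R)"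
  obtain a b c d where xe: "x = (a, b, c, d)" by (cases x)
  have cl: "a \<in> carrier R" "b \<in> carrier R" "c \<in> carrier R" "d \<in> carrier R"
    and det: "a \<otimes> d \<ominus> b \<otimes> c = \<one>"
    using x by (auto simp: SL2_def xe)
  have "d \<otimes> a \<ominus> (\<ominus> b) \<otimes> (\<ominus> c) = a \<otimes> d \<ominus> b \<otimes> c"
    "d \<otimes> a \<oplus> (\<ominus> b) \<otimes> c = a \<otimes> d \<ominus> b \<otimes> c"
    "d \<otimes> b \<oplus> (\<ominus> b) \<otimes> d = \<zero>"
    "(\<ominus> c) \<otimes> a \<oplus> a \<otimes> c = \<zero>"
    "(\<ominus> c) \<otimes> b \<oplus> a \<otimes> d = a \<otimes> d \<ominus> b \<otimes> c"
    using cl by algebra+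
  then have "(d, \<ominus> b, \<ominus> c, a) \<in> carrier (SL2 R)"
    and "(d, \<ominus> b, \<ominus> c, a) \<otimes>\<^bsub>SL2 R\<^esub> x = \<one>\<^bsub>SL2 R\<^esub>"
    using cl det by (auto simp: SL2_def xe)
  then show "\<exists>y\<in>carrier (SL2 R). y \<otimes>\<^bsub>SL2 R\<^esub> x = \<one>\<^bsub>SL2 R\<^esub>" by blast
qed

text \<open>
  The element \<open>\<Sum> f(x) x\<close> of the complex group algebra is encoded as the function \<open>f\<close>,
  extended by zero outside the group, and the product is convolution. This is the group
  algebra only for finite groups: there is no finite-support condition on \<open>f\<close>.
\<close>

definition group_algebra :: "('g, 'm) monoid_scheme \<Rightarrow> (complex, 'g \<Rightarrow> complex) module" where
  "group_algebra G = \<lparr>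
     carrier = {f. \<forall>x. x \<notin> carrier G \<longrightarrow> f x = 0},
     monoid.mult = (\<lambda>f g x. if x \<in> carrier G
                      then \<Sum>y\<in>carrier G. f y * g (inv\<^bsub>G\<^esub> y \<otimes>\<^bsub>G\<^esub> x) else 0),
     one = (\<lambda>x. if x = \<one>\<^bsub>G\<^esub> then 1 else 0),
     ring.zero = (\<lambda>x. 0),
     ring.add = (\<lambda>f g x. f x + g x),
     smult = (\<lambda>c f x. c * f x)\<rparr>"

lemma (in group) group_algebra_ring:
  assumes fin: "finite (carrier G)"
  shows "ring (group_algebra G)"
proof -
  have shift: "(\<Sum>y\<in>carrier G. F (z \<otimes> y)) = (\<Sum>y\<in>carrier G. F y)"
    if "z \<in> carrier G" for z and F :: "'a \<Rightarrow> complex"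
    by (rule sum.reindex_bij_witness[where i = "\<lambda>y. inv z \<otimes> y" and j = "\<lambda>y. z \<otimes> y"])
       (use that in \<open>auto simp: m_assoc[symmetric]\<close>)
  show ?thesis
  proof (rule ringI)
    show "abelian_group (group_algebra G)"
    proof (rule abelian_groupI)
      fix f assume "f \<in> carrier (group_algebra G)"
      then show "\<exists>g\<in>carrier (group_algebra G). g \<oplus>\<^bsub>group_algebra G\<^esub> f = \<zero>\<^bsub>group_algebra G\<^esub>"
        by (intro bexI[of _ "\<lambda>x. - f x"]) (auto simp: group_algebra_def)
    qed (auto simp: group_algebra_def algebra_simps)
    show "Group.monoid (group_algebra G)"
    proof (rule monoidI)
      fix f g h assume "f \<in> carrier (group_algebra G)" "g \<in> carrier (group_algebra G)"
        "h \<in> carrier (group_algebra G)"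
      have "(\<Sum>y\<in>carrier G. (\<Sum>z\<in>carrier G. f z * g (inv z \<otimes> y)) * h (inv y \<otimes> x))
          = (\<Sum>y\<in>carrier G. f y * (\<Sum>z\<in>carrier G. g z * h (inv z \<otimes> (inv y \<otimes> x))))"
        if x: "x \<in> carrier G" for x
      proof -
        have "(\<Sum>y\<in>carrier G. (\<Sum>z\<in>carrier G. f z * g (inv z \<otimes> y)) * h (inv y \<otimes> x))
            = (\<Sum>z\<in>carrier G. \<Sum>y\<in>carrier G. f z * g (inv z \<otimes> y) * h (inv y \<otimes> x))"
          by (simp add: sum_distrib_right) (rule sum.swap)
        also have "\<dots> = (\<Sum>z\<in>carrier G. \<Sum>y\<in>carrier G.
            f z * g (inv z \<otimes> (z \<otimes> y)) * h (inv (z \<otimes> y) \<otimes> x))"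
          by (rule sum.cong[OF refl],
              rule shift[where F = "\<lambda>y. f z * g (inv z \<otimes> y) * h (inv y \<otimes> x)" for z, symmetric])
        also have "\<dots> = (\<Sum>z\<in>carrier G. f z * (\<Sum>y\<in>carrier G. g y * h (inv y \<otimes> (inv z \<otimes> x))))"
          using x by (simp add: sum_distrib_left mult.assoc m_assoc[symmetric] inv_mult_group)
        finally show ?thesis .
      qed
      then show "f \<otimes>\<^bsub>group_algebra G\<^esub> g \<otimes>\<^bsub>group_algebra G\<^esub> h
          = f \<otimes>\<^bsub>group_algebra G\<^esub> (g \<otimes>\<^bsub>group_algebra G\<^esub> h)"
        by (auto simp: group_algebra_def fun_eq_iff intro!: sum.cong)
    next
      fix f assume f: "f \<in> carrier (group_algebra G)"
      have "(\<Sum>y\<in>carrier G. (if y = \<one> then 1 else 0) * f (inv y \<otimes> x)) = f x"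
        if "x \<in> carrier G" for x
      proof -
        have "(\<Sum>y\<in>carrier G. (if y = \<one> then 1 else 0) * f (inv y \<otimes> x))
            = (\<Sum>y\<in>carrier G. if y = \<one> then f x else 0)"
          using that by (intro sum.cong) auto
        then show ?thesis using fin by simp
      qed
      then show "\<one>\<^bsub>group_algebra G\<^esub> \<otimes>\<^bsub>group_algebra G\<^esub> f = f"
        using f by (auto simp: group_algebra_def fun_eq_iff)
      have "(\<Sum>y\<in>carrier G. f y * (if inv y \<otimes> x = \<one> then 1 else 0)) = f x"
        if x: "x \<in> carrier G" for x
      proof -
        have "inv y \<otimes> x = \<one> \<longleftrightarrow> y = x" if "y \<in> carrier G" for y
          using that x by (metis inv_closed inv_inv inv_equality l_inv)
        then have "(\<Sum>y\<in>carrier G. f y * (if inv y \<otimes> x = \<one> then 1 else 0))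
            = (\<Sum>y\<in>carrier G. if y = x then f x else 0)"
          by (intro sum.cong) auto
        then show ?thesis using fin x by simp
      qed
      then show "f \<otimes>\<^bsub>group_algebra G\<^esub> \<one>\<^bsub>group_algebra G\<^esub> = f"
        using f by (auto simp: group_algebra_def fun_eq_iff)
    qed (auto simp: group_algebra_def)
  qed (auto simp: group_algebra_def fun_eq_iff algebra_simps sum.distrib)
qed

text \<open>
  The locale \<open>algebra\<close> of HOL-Algebra covers commutative algebras only, so isomorphisms are
  defined on the underlying record; the scalars are all of type \<open>complex\<close>.
\<close>

definition complex_alg_iso ::
    "(complex, 'a, 'm) module_scheme \<Rightarrow> (complex, 'b, 'n) module_scheme \<Rightarrow> ('a \<Rightarrow> 'b) set" where
  "complex_alg_iso A B =
     {h \<in> ring_iso A B. \<forall>c. \<forall>x\<in>carrier A. h (c \<odot>\<^bsub>A\<^esub> x) = c \<odot>\<^bsub>B\<^esub> h x}"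

definition is_complex_alg_iso ::
    "(complex, 'a, 'm) module_scheme \<Rightarrow> (complex, 'b, 'n) module_scheme \<Rightarrow> bool"
    (infix \<open>\<cong>\<^sub>\<complex>\<close> 60) where
  "A \<cong>\<^sub>\<complex> B \<longleftrightarrow> complex_alg_iso A B \<noteq> {}"

definition trunc_poly_ring :: "('a, 'm) ring_scheme \<Rightarrow> nat \<Rightarrow> (nat \<Rightarrow> 'a) set ring" where
  "trunc_poly_ring R k = UP R Quot (PIdl\<^bsub>UP R\<^esub> (monom (UP R) \<one>\<^bsub>R\<^esub> k))"

lemma (in cring) trunc_poly_ring_cring: "cring (trunc_poly_ring R k)"
proof -
  interpret UP_cring R "UP R" by unfold_locales simp
  show ?thesis
    unfolding trunc_poly_ring_def
    by (intro ideal.quotient_is_cring P.cgenideal_ideal monom_closed P.is_cring) auto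
qed

end

theory Submission
  imports Defs
begin

text \<open>
  For every \<open>d\<close> a complex group algebra determines the number of irreducible representations of
  degree \<open>d\<close>. The two algebras differ already in degree two: over \<open>\<int>/2\<^sup>k\<close> there are at least three
  such representations, over \<open>\<F>\<^sub>2[t]/(t\<^sup>k)\<close> there are at most two. The role of irreducibility is played
  by a property that needs no theory of modules: two elements of the image do not commute.
  Write \<open>U(x)\<close> and \<open>L(x)\<close> for the upper and lower unipotent matrices with off-diagonal entry \<open>x\<close>.

  In characteristic two every \<open>U(x)\<close> is an involution, and all of them commute. If a representation
  into the two by two matrices is not commutative, then \<open>\<tau> = U(1)\<close> and \<open>\<tau>' = L(1)\<close> become two
  noncommuting involutions generating a copy of the symmetric group \<open>S\<^sub>3\<close>, and the only involutions
  commuting with \<open>\<tau>\<close> are \<open>\<plusminus>1\<close> and \<open>\<plusminus>\<tau>\<close>. Conjugation by the diagonal matrix with first entry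
  \<open>1 + t\<close> then forces \<open>U(t\<^sup>2 x)\<close> to act as \<open>1\<close> and \<open>U(t)\<close> to act as a sign. Since every \<open>x\<close> is
  \<open>i + t j + t\<^sup>2 r\<close> with \<open>i\<close> and \<open>j\<close> equal to \<open>0\<close> or \<open>1\<close>, this single sign determines the image of each
  elementary matrix as a signed word in \<open>\<tau>\<close> and \<open>\<tau>'\<close>, and with it the character
  (lemma \<open>character_determined\<close>).

  Over \<open>\<int>/2\<^sup>k\<close> with \<open>k \<ge> 3\<close> one can reduce modulo \<open>8\<close>, and \<open>SL\<^sub>2(\<int>/8)\<close> maps onto the binary
  octahedral group of order \<open>48\<close>. That group has three irreducible representations of degree two,
  with traces \<open>\<surd>2\<close>, \<open>-\<surd>2\<close> and \<open>0\<close> at the image of \<open>U(1)\<close>. They are constructed from the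
  Bruhat decomposition: the locale \<open>SL2_mod_8_relations\<close> lists the relations that the images of \<open>U(1)\<close> and of
  the Weyl element must satisfy for the resulting formula to be multiplicative.

  Finally, an isomorphism of the group algebras would carry these three characters to three
  characters in characteristic two. Two of them would share their sign, hence agree, although the
  traces at \<open>U(1)\<close> are distinct.
\<close>

section \<open>Complex two by two matrices\<close>

text \<open>
  A type of its own, so that the matrix product is the multiplication of a ring.
\<close>

datatype mat2 = Mat2 complex complex complex complex

instantiation mat2 :: ring_1
begin

definition zero_mat2 :: mat2 where "zero_mat2 = Mat2 0 0 0 0"

definition one_mat2 :: mat2 where "one_mat2 = Mat2 1 0 0 1"

fun plus_mat2 :: "mat2 \<Rightarrow> mat2 \<Rightarrow> mat2" where
  "plus_mat2 (Mat2 a b c d) (Mat2 a' b' c' d') = Mat2 (a + a') (b + b') (c + c') (d + d')"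

fun uminus_mat2 :: "mat2 \<Rightarrow> mat2" where
  "uminus_mat2 (Mat2 a b c d) = Mat2 (- a) (- b) (- c) (- d)"

fun minus_mat2 :: "mat2 \<Rightarrow> mat2 \<Rightarrow> mat2" where
  "minus_mat2 (Mat2 a b c d) (Mat2 a' b' c' d') = Mat2 (a - a') (b - b') (c - c') (d - d')"

fun times_mat2 :: "mat2 \<Rightarrow> mat2 \<Rightarrow> mat2" where
  "times_mat2 (Mat2 a b c d) (Mat2 a' b' c' d') =
     Mat2 (a * a' + b * c') (a * b' + b * d') (c * a' + d * c') (c * b' + d * d')"

instance
proof
  fix A B C :: mat2
  show "A * B * C = A * (B * C)" "A + B + C = A + (B + C)" "A + B = B + A"
    "(A + B) * C = A * C + B * C" "A * (B + C) = A * B + A * C"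
    by (cases A; cases B; cases C; simp add: algebra_simps)+
  show "1 * A = A" "A * 1 = A" "0 + A = A" "- A + A = 0"
    by (cases A; simp add: one_mat2_def zero_mat2_def)+
  show "A - B = A + (- B)"
    by (cases A; cases B; simp)
  show "(0::mat2) \<noteq> 1"
    by (simp add: one_mat2_def zero_mat2_def)
qed

end

fun cscale :: "complex \<Rightarrow> mat2 \<Rightarrow> mat2" (infixr \<open>\<bullet>\<close> 75) where
  "c \<bullet> Mat2 x y z u = Mat2 (c * x) (c * y) (c * z) (c * u)"

fun tr :: "mat2 \<Rightarrow> complex" where
  "tr (Mat2 a b c d) = a + d"

lemma tr_linear [simp]: "tr (A + B) = tr A + tr B" "tr (- A) = - tr A" "tr (c \<bullet> A) = c * tr A"
  "tr 0 = 0" "tr 1 = 2"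
  by (cases A; cases B; simp add: one_mat2_def zero_mat2_def algebra_simps)+

lemma tr_commute: "tr (A * B) = tr (B * A)"
  by (cases A; cases B; simp add: algebra_simps)

lemma tr_sum: "tr (sum F S) = (\<Sum>x\<in>S. tr (F x))"
  by (induction S rule: infinite_finite_induct) auto

lemma cscale_simps [simp]: "1 \<bullet> A = A" "0 \<bullet> A = 0" "c \<bullet> 0 = 0"
  by (cases A; simp add: zero_mat2_def)+

lemma cscale_algebra: "(c + e) \<bullet> A = c \<bullet> A + e \<bullet> A" "c \<bullet> (A + B) = c \<bullet> A + c \<bullet> B"
  "c \<bullet> e \<bullet> A = (c * e) \<bullet> A" "(c \<bullet> A) * B = c \<bullet> (A * B)" "A * (c \<bullet> B) = c \<bullet> (A * B)"
  by (cases A; cases B; simp add: algebra_simps)+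

lemma cscale_sum_right: "c \<bullet> sum F S = (\<Sum>x\<in>S. c \<bullet> F x)"
  by (induction S rule: infinite_finite_induct) (auto simp: cscale_algebra)

lemma cscale_sum_left: "sum f S \<bullet> A = (\<Sum>x\<in>S. f x \<bullet> A)"
  by (induction S rule: infinite_finite_induct) (auto simp: cscale_algebra)

section \<open>Representations along an isomorphism of group algebras\<close>

definition rep2 :: "('g, 'm) monoid_scheme \<Rightarrow> ('g \<Rightarrow> mat2) \<Rightarrow> bool" where
  "rep2 G \<rho> \<longleftrightarrow> \<rho> \<one>\<^bsub>G\<^esub> = 1 \<and> (\<forall>x\<in>carrier G. \<forall>y\<in>carrier G. \<rho> (x \<otimes>\<^bsub>G\<^esub> y) = \<rho> x * \<rho> y)"

definition commuting_on :: "'g set \<Rightarrow> ('g \<Rightarrow> mat2) \<Rightarrow> bool" where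
  "commuting_on S \<rho> \<longleftrightarrow> (\<forall>x\<in>S. \<forall>y\<in>S. \<rho> x * \<rho> y = \<rho> y * \<rho> x)"

definition point :: "'g \<Rightarrow> 'g \<Rightarrow> complex" where
  "point g = (\<lambda>x. if x = g then 1 else 0)"

definition rep_ext :: "('g, 'm) monoid_scheme \<Rightarrow> ('g \<Rightarrow> mat2) \<Rightarrow> ('g \<Rightarrow> complex) \<Rightarrow> mat2" where
  "rep_ext G \<rho> f = (\<Sum>g\<in>carrier G. f g \<bullet> \<rho> g)"

lemma point_closed: "g \<in> carrier G \<Longrightarrow> point g \<in> carrier (group_algebra G)"
  by (auto simp: point_def group_algebra_def)

lemma rep_ext_point:
  assumes "finite (carrier G)" and "g \<in> carrier G"
  shows "rep_ext G \<rho> (point g) = \<rho> g"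
proof -
  have "rep_ext G \<rho> (point g) = (\<Sum>x\<in>carrier G. if x = g then \<rho> g else 0)"
    unfolding rep_ext_def point_def by (intro sum.cong) auto
  then show ?thesis
    using assms by simp
qed

lemma (in group) point_mult:
  assumes fin: "finite (carrier G)" and g: "g \<in> carrier G" and k: "k \<in> carrier G"
  shows "point g \<otimes>\<^bsub>group_algebra G\<^esub> point k = point (g \<otimes> k)"
proof
  fix x
  have "(\<Sum>y\<in>carrier G. point g y * point k (inv y \<otimes> x)) = point (g \<otimes> k) x"
    if x: "x \<in> carrier G"
  proof -
    have "(\<Sum>y\<in>carrier G. point g y * point k (inv y \<otimes> x))
        = (\<Sum>y\<in>carrier G. if y = g then point k (inv g \<otimes> x) else 0)"
      by (intro sum.cong) (auto simp: point_def)
    also have "\<dots> = point k (inv g \<otimes> x)"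
      using fin g by simp
    also have "\<dots> = point (g \<otimes> k) x"
      using g k x by (auto simp: point_def inv_solve_left')
    finally show ?thesis .
  qed
  then show "(point g \<otimes>\<^bsub>group_algebra G\<^esub> point k) x = point (g \<otimes> k) x"
    using g k by (auto simp: group_algebra_def) (auto simp: point_def)
qed

lemma (in group) rep_ext_mult:
  assumes rep: "rep2 G \<rho>"
  shows "rep_ext G \<rho> (f \<otimes>\<^bsub>group_algebra G\<^esub> g) = rep_ext G \<rho> f * rep_ext G \<rho> g"
proof -
  have shift: "(\<Sum>x\<in>carrier G. F x) = (\<Sum>z\<in>carrier G. F (y \<otimes> z))"
    if "y \<in> carrier G" for y and F :: "'a \<Rightarrow> mat2"
    by (rule sum.reindex_bij_witness[where j = "\<lambda>x. inv y \<otimes> x" and i = "\<lambda>x. y \<otimes> x"])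
       (use that in \<open>auto simp: m_assoc[symmetric]\<close>)
  have "rep_ext G \<rho> (f \<otimes>\<^bsub>group_algebra G\<^esub> g)
      = (\<Sum>x\<in>carrier G. \<Sum>y\<in>carrier G. (f y * g (inv y \<otimes> x)) \<bullet> \<rho> x)"
    by (simp add: rep_ext_def group_algebra_def cscale_sum_left)
  also have "\<dots> = (\<Sum>y\<in>carrier G. \<Sum>x\<in>carrier G. (f y * g (inv y \<otimes> x)) \<bullet> \<rho> x)"
    by (rule sum.swap)
  also have "\<dots> = (\<Sum>y\<in>carrier G. \<Sum>z\<in>carrier G. (f y * g (inv y \<otimes> (y \<otimes> z))) \<bullet> \<rho> (y \<otimes> z))"
    by (rule sum.cong[OF refl], rule shift)
  also have "\<dots> = (\<Sum>y\<in>carrier G. \<Sum>z\<in>carrier G. (f y \<bullet> \<rho> y) * (g z \<bullet> \<rho> z))"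
    using rep by (intro sum.cong refl) (simp add: m_assoc[symmetric] rep2_def cscale_algebra mult.commute)
  also have "\<dots> = rep_ext G \<rho> f * rep_ext G \<rho> g"
    by (simp add: rep_ext_def sum_product)
  finally show ?thesis .
qed

text \<open>
  Additivity gives the claim by adding the elements of the support one at a time; homogeneity
  evaluates the function supported on a single element.
\<close>

lemma linear_expansion:
  fixes \<psi> :: "('g \<Rightarrow> complex) \<Rightarrow> mat2"
  assumes fin: "finite (carrier G)"
    and add: "\<And>f g. f \<in> carrier (group_algebra G) \<Longrightarrow> g \<in> carrier (group_algebra G) \<Longrightarrow>
                \<psi> (\<lambda>x. f x + g x) = \<psi> f + \<psi> g"
    and scale: "\<And>c f. f \<in> carrier (group_algebra G) \<Longrightarrow> \<psi> (\<lambda>x. c * f x) = c \<bullet> \<psi> f"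
    and f: "f \<in> carrier (group_algebra G)"
  shows "\<psi> f = rep_ext G (\<lambda>g. \<psi> (point g)) f"
proof -
  have "\<psi> (\<lambda>x. if x \<in> S then f x else 0) = (\<Sum>g\<in>S. f g \<bullet> \<psi> (point g))"
    if "finite S" and "S \<subseteq> carrier G" for S
    using that
  proof (induction S rule: finite_induct)
    case empty
    show ?case
      using scale[OF f, of 0] by simp
  next
    case (insert s S)
    have "(\<lambda>x. if x \<in> insert s S then f x else 0)
        = (\<lambda>x. f s * point s x + (if x \<in> S then f x else 0))"
      using insert.hyps by (auto simp: point_def fun_eq_iff)
    moreover have "(\<lambda>x. f s * point s x) \<in> carrier (group_algebra G)"
      "(\<lambda>x. if x \<in> S then f x else 0) \<in> carrier (group_algebra G)"
      using insert.prems by (auto simp: group_algebra_def point_def)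
    ultimately have "\<psi> (\<lambda>x. if x \<in> insert s S then f x else 0)
        = \<psi> (\<lambda>x. f s * point s x) + \<psi> (\<lambda>x. if x \<in> S then f x else 0)"
      by (simp only: add)
    then show ?case
      using insert by (simp add: scale point_closed)
  qed
  from this[OF fin order_refl] have "\<psi> (\<lambda>x. if x \<in> carrier G then f x else 0) = rep_ext G (\<lambda>g. \<psi> (point g)) f"
    by (simp add: rep_ext_def)
  moreover have "(\<lambda>x. if x \<in> carrier G then f x else 0) = f"
    using f by (auto simp: group_algebra_def)
  ultimately show ?thesis by simp
qed

text \<open>
  An isomorphism of group algebras need not come from a map of groups, so a group element is sent
  to its image in the other algebra, on which the linear extension of \<open>\<rho>\<close> is evaluated.
\<close>

definition pullback_rep ::
    "('g, 'm) monoid_scheme \<Rightarrow> (('h \<Rightarrow> complex) \<Rightarrow> 'g \<Rightarrow> complex) \<Rightarrow> ('g \<Rightarrow> mat2) \<Rightarrow> 'h \<Rightarrow> mat2" where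
  "pullback_rep G h \<rho> = (\<lambda>g. rep_ext G \<rho> (h (point g)))"

context
  fixes G :: "('g, 'm) monoid_scheme" and H :: "('h, 'n) monoid_scheme" and h
  assumes G: "group G" and H: "group H"
    and finG: "finite (carrier G)" and finH: "finite (carrier H)"
    and h: "h \<in> complex_alg_iso (group_algebra H) (group_algebra G)"
begin

lemma rep_ext_pullback:
  assumes f: "f \<in> carrier (group_algebra H)"
  shows "rep_ext G \<rho> (h f) = rep_ext H (pullback_rep G h \<rho>) f"
  unfolding pullback_rep_def
proof (rule linear_expansion[OF finH _ _ f])
  fix f g assume "f \<in> carrier (group_algebra H)" "g \<in> carrier (group_algebra H)"
  then have "h (\<lambda>x. f x + g x) = (\<lambda>x. h f x + h g x)"
    using h unfolding complex_alg_iso_def ring_iso_def ring_hom_def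
    by (auto simp: group_algebra_def)
  then show "rep_ext G \<rho> (h (\<lambda>x. f x + g x)) = rep_ext G \<rho> (h f) + rep_ext G \<rho> (h g)"
    by (simp add: rep_ext_def cscale_algebra sum.distrib)
next
  fix c f assume "f \<in> carrier (group_algebra H)"
  then have "h (\<lambda>x. c * f x) = (\<lambda>x. c * h f x)"
    using h unfolding complex_alg_iso_def by (auto simp: group_algebra_def)
  then show "rep_ext G \<rho> (h (\<lambda>x. c * f x)) = c \<bullet> rep_ext G \<rho> (h f)"
    by (simp add: rep_ext_def cscale_algebra cscale_sum_right)
qed

lemma rep2_pullback:
  assumes rep: "rep2 G \<rho>"
  shows "rep2 H (pullback_rep G h \<rho>)"
  unfolding rep2_def
proof (intro conjI ballI)
  have "point \<one>\<^bsub>H\<^esub> = \<one>\<^bsub>group_algebra H\<^esub>" "point \<one>\<^bsub>G\<^esub> = \<one>\<^bsub>group_algebra G\<^esub>"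
    by (auto simp: point_def group_algebra_def fun_eq_iff)
  moreover have "h \<one>\<^bsub>group_algebra H\<^esub> = \<one>\<^bsub>group_algebra G\<^esub>"
    using h by (auto simp: complex_alg_iso_def ring_iso_def ring_hom_def)
  ultimately show "pullback_rep G h \<rho> \<one>\<^bsub>H\<^esub> = 1"
    using rep_ext_point[OF finG, of "\<one>\<^bsub>G\<^esub>" \<rho>] G rep
    by (simp add: pullback_rep_def rep2_def group.is_monoid)
next
  fix x y assume xy: "x \<in> carrier H" "y \<in> carrier H"
  have "h (point (x \<otimes>\<^bsub>H\<^esub> y)) = h (point x) \<otimes>\<^bsub>group_algebra G\<^esub> h (point y)"
    using h xy by (auto simp: complex_alg_iso_def ring_iso_def ring_hom_def point_closed
        group.point_mult[OF H finH xy, symmetric])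
  then show "pullback_rep G h \<rho> (x \<otimes>\<^bsub>H\<^esub> y) = pullback_rep G h \<rho> x * pullback_rep G h \<rho> y"
    by (simp add: pullback_rep_def group.rep_ext_mult[OF G rep])
qed

lemma point_in_image:
  assumes "g \<in> carrier G"
  obtains f where "f \<in> carrier (group_algebra H)" "h f = point g"
proof -
  have "h ` carrier (group_algebra H) = carrier (group_algebra G)"
    using h by (auto simp: complex_alg_iso_def ring_iso_def bij_betw_def)
  then show thesis
    using that point_closed[OF assms] by (metis imageE)
qed

text \<open>
  The group elements span the algebra and \<open>h\<close> is onto: if the images of the elements of \<open>H\<close> commute,
  then so do all their linear combinations, among them the values of \<open>\<rho>\<close>.
\<close>

lemma pullback_commuting:
  assumes "commuting_on (carrier H) (pullback_rep G h \<rho>)"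
  shows "commuting_on (carrier G) \<rho>"
  unfolding commuting_on_def
proof (intro ballI)
  fix x y assume x: "x \<in> carrier G" and y: "y \<in> carrier G"
  obtain f g where f: "f \<in> carrier (group_algebra H)" "h f = point x"
    and g: "g \<in> carrier (group_algebra H)" "h g = point y"
    using point_in_image x y by metis
  let ?\<sigma> = "pullback_rep G h \<rho>"
  have "rep_ext H ?\<sigma> f * rep_ext H ?\<sigma> g
      = (\<Sum>a\<in>carrier H. \<Sum>b\<in>carrier H. (f a * g b) \<bullet> (?\<sigma> a * ?\<sigma> b))"
    by (simp add: rep_ext_def sum_product cscale_algebra mult.commute)
  also have "\<dots> = (\<Sum>a\<in>carrier H. \<Sum>b\<in>carrier H. (f a * g b) \<bullet> (?\<sigma> b * ?\<sigma> a))"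
    using assms by (intro sum.cong refl) (simp add: commuting_on_def)
  also have "\<dots> = (\<Sum>b\<in>carrier H. \<Sum>a\<in>carrier H. (f a * g b) \<bullet> (?\<sigma> b * ?\<sigma> a))"
    by (rule sum.swap)
  also have "\<dots> = rep_ext H ?\<sigma> g * rep_ext H ?\<sigma> f"
    by (simp add: rep_ext_def sum_product cscale_algebra mult.commute)
  finally show "\<rho> x * \<rho> y = \<rho> y * \<rho> x"
    using rep_ext_pullback[OF f(1), of \<rho>] rep_ext_pullback[OF g(1), of \<rho>] x y
    by (simp add: f g rep_ext_point[OF finG])
qed

text \<open>
  A character of the algebra is determined by its values on the group elements of either side,
  although \<open>h\<close> does not match these elements.
\<close>

lemma pullback_character:
  assumes "\<And>x. x \<in> carrier H \<Longrightarrow> tr (pullback_rep G h \<rho>\<^sub>1 x) = tr (pullback_rep G h \<rho>\<^sub>2 x)"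
    and g: "g \<in> carrier G"
  shows "tr (\<rho>\<^sub>1 g) = tr (\<rho>\<^sub>2 g)"
proof -
  obtain f where f: "f \<in> carrier (group_algebra H)" "h f = point g"
    using point_in_image g by metis
  have "tr (rep_ext H (pullback_rep G h \<rho>\<^sub>1) f) = tr (rep_ext H (pullback_rep G h \<rho>\<^sub>2) f)"
    using assms(1) by (simp add: rep_ext_def tr_sum)
  then show ?thesis
    using rep_ext_pullback[OF f(1), of \<rho>\<^sub>1] rep_ext_pullback[OF f(1), of \<rho>\<^sub>2] g
    by (simp add: f rep_ext_point[OF finG])
qed

end

section \<open>Generation of SL2 by elementary matrices\<close>

definition uni_upper :: "('a, 'm) ring_scheme \<Rightarrow> 'a \<Rightarrow> 'a \<times> 'a \<times> 'a \<times> 'a" where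
  "uni_upper R x = (\<one>\<^bsub>R\<^esub>, x, \<zero>\<^bsub>R\<^esub>, \<one>\<^bsub>R\<^esub>)"

definition uni_lower :: "('a, 'm) ring_scheme \<Rightarrow> 'a \<Rightarrow> 'a \<times> 'a \<times> 'a \<times> 'a" where
  "uni_lower R x = (\<one>\<^bsub>R\<^esub>, \<zero>\<^bsub>R\<^esub>, x, \<one>\<^bsub>R\<^esub>)"

lemma SL2_mult [simp]:
  "(a, b, c, d) \<otimes>\<^bsub>SL2 R\<^esub> (a', b', c', d') =
     (a \<otimes>\<^bsub>R\<^esub> a' \<oplus>\<^bsub>R\<^esub> b \<otimes>\<^bsub>R\<^esub> c', a \<otimes>\<^bsub>R\<^esub> b' \<oplus>\<^bsub>R\<^esub> b \<otimes>\<^bsub>R\<^esub> d',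
      c \<otimes>\<^bsub>R\<^esub> a' \<oplus>\<^bsub>R\<^esub> d \<otimes>\<^bsub>R\<^esub> c', c \<otimes>\<^bsub>R\<^esub> b' \<oplus>\<^bsub>R\<^esub> d \<otimes>\<^bsub>R\<^esub> d')"
  by (simp add: SL2_def)

lemma SL2_carrier:
  "(a, b, c, d) \<in> carrier (SL2 R) \<longleftrightarrow> a \<in> carrier R \<and> b \<in> carrier R \<and> c \<in> carrier R \<and> d \<in> carrier R \<and>
     a \<otimes>\<^bsub>R\<^esub> d \<ominus>\<^bsub>R\<^esub> b \<otimes>\<^bsub>R\<^esub> c = \<one>\<^bsub>R\<^esub>"
  by (simp add: SL2_def)

lemma SL2_one: "\<one>\<^bsub>SL2 R\<^esub> = (\<one>\<^bsub>R\<^esub>, \<zero>\<^bsub>R\<^esub>, \<zero>\<^bsub>R\<^esub>, \<one>\<^bsub>R\<^esub>)"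
  by (simp add: SL2_def)

context cring
begin

lemma uni_upper_closed [simp]: "x \<in> carrier R \<Longrightarrow> uni_upper R x \<in> carrier (SL2 R)"
  unfolding uni_upper_def SL2_carrier by simp algebra

lemma uni_lower_closed [simp]: "x \<in> carrier R \<Longrightarrow> uni_lower R x \<in> carrier (SL2 R)"
  unfolding uni_lower_def SL2_carrier by simp algebra

lemma uni_upper_add: "x \<in> carrier R \<Longrightarrow> y \<in> carrier R \<Longrightarrow> uni_upper R x \<otimes>\<^bsub>SL2 R\<^esub> uni_upper R y = uni_upper R (x \<oplus> y)"
  by (simp add: uni_upper_def a_comm)

lemma uni_lower_add: "x \<in> carrier R \<Longrightarrow> y \<in> carrier R \<Longrightarrow> uni_lower R x \<otimes>\<^bsub>SL2 R\<^esub> uni_lower R y = uni_lower R (x \<oplus> y)"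
  by (simp add: uni_lower_def)

text \<open>
  The product \<open>U(x) L(c) U(y)\<close> has diagonal entries \<open>1 + x c\<close> and \<open>1 + c y\<close>, which can be prescribed
  when \<open>c\<close> is a unit; the last entry is then forced by the determinant.
\<close>

lemma elementary_factorization:
  assumes g: "(a, b, c, d) \<in> carrier (SL2 R)" and c: "c \<in> Units R"
  obtains x y where "x \<in> carrier R" "y \<in> carrier R"
    "(a, b, c, d) = uni_upper R x \<otimes>\<^bsub>SL2 R\<^esub> (uni_lower R c \<otimes>\<^bsub>SL2 R\<^esub> uni_upper R y)"
proof -
  have cl: "a \<in> carrier R" "b \<in> carrier R" "c \<in> carrier R" "d \<in> carrier R"
    and det: "a \<otimes> d \<ominus> b \<otimes> c = \<one>"
    using g by (auto simp: SL2_carrier)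
  obtain v where v: "v \<in> carrier R" "v \<otimes> c = \<one>"
    using c by (auto simp: Units_def)
  let ?x = "(a \<ominus> \<one>) \<otimes> v" and ?y = "(d \<ominus> \<one>) \<otimes> v"
  have "\<one> \<oplus> ?x \<otimes> c = \<one> \<oplus> (a \<ominus> \<one>) \<otimes> (v \<otimes> c)"
    using cl v(1) by algebra
  also have "\<dots> = a"
    unfolding v(2) using cl by algebra
  finally have a: "\<one> \<oplus> ?x \<otimes> c = a" .
  have "c \<otimes> ?y \<oplus> \<one> = \<one> \<oplus> (d \<ominus> \<one>) \<otimes> (v \<otimes> c)"
    using cl v(1) by algebra
  also have "\<dots> = d"
    unfolding v(2) using cl by algebra
  finally have d: "c \<otimes> ?y \<oplus> \<one> = d" .
  have "?y \<oplus> ?x \<otimes> d = v \<otimes> ((a \<otimes> d \<ominus> b \<otimes> c) \<oplus> b \<otimes> c \<ominus> \<one>)"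
    using cl v(1) by algebra
  also have "\<dots> = (v \<otimes> c) \<otimes> b"
    unfolding det using cl v(1) by algebra
  also have "\<dots> = b"
    unfolding v(2) using cl by algebra
  finally have b: "?y \<oplus> ?x \<otimes> d = b" .
  show thesis
  proof (rule that[of ?x ?y])
    show "(a, b, c, d) = uni_upper R ?x \<otimes>\<^bsub>SL2 R\<^esub> (uni_lower R c \<otimes>\<^bsub>SL2 R\<^esub> uni_upper R ?y)"
      using cl v a b d by (simp add: uni_upper_def uni_lower_def)
  qed (use cl v in auto)
qed

text \<open>
  The hypothesis \<open>unit\<close> holds in a local ring: if \<open>c\<close> is not a unit, then \<open>a\<close> is one, and
  left multiplication by \<open>L(1)\<close> brings the unit \<open>a + c\<close> into the lower left corner.
\<close>

lemma SL2_elementary_induct: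
  assumes g: "g \<in> carrier (SL2 R)"
    and unit: "\<And>a b c d. (a, b, c, d) \<in> carrier (SL2 R) \<Longrightarrow> c \<in> Units R \<or> a \<oplus> c \<in> Units R"
    and one: "P \<one>\<^bsub>SL2 R\<^esub>"
    and up: "\<And>x g. x \<in> carrier R \<Longrightarrow> g \<in> carrier (SL2 R) \<Longrightarrow> P g \<Longrightarrow> P (uni_upper R x \<otimes>\<^bsub>SL2 R\<^esub> g)"
    and low: "\<And>x g. x \<in> carrier R \<Longrightarrow> g \<in> carrier (SL2 R) \<Longrightarrow> P g \<Longrightarrow> P (uni_lower R x \<otimes>\<^bsub>SL2 R\<^esub> g)"
  shows "P g"
proof -
  interpret S: group "SL2 R" by (rule SL2_group)
  have main: "P (a, b, c, d)" if h: "(a, b, c, d) \<in> carrier (SL2 R)" and c: "c \<in> Units R" for a b c d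
  proof -
    obtain x y where xy: "x \<in> carrier R" "y \<in> carrier R"
      "(a, b, c, d) = uni_upper R x \<otimes>\<^bsub>SL2 R\<^esub> (uni_lower R c \<otimes>\<^bsub>SL2 R\<^esub> (uni_upper R y \<otimes>\<^bsub>SL2 R\<^esub> \<one>\<^bsub>SL2 R\<^esub>))"
      using elementary_factorization[OF h c] by (metis S.r_one uni_upper_closed)
    show ?thesis
      unfolding xy(3) by (intro up low one) (use xy c in auto)
  qed
  obtain a b c d where ge: "g = (a, b, c, d)" by (cases g)
  have cl: "a \<in> carrier R" "b \<in> carrier R" "c \<in> carrier R" "d \<in> carrier R"
    using g by (auto simp: ge SL2_carrier)
  consider "c \<in> Units R" | "a \<oplus> c \<in> Units R"
    using unit g ge by blast
  then show ?thesis
  proof cases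
    case 1
    then show ?thesis using main g ge by blast
  next
    case 2
    let ?h = "uni_lower R \<one> \<otimes>\<^bsub>SL2 R\<^esub> g"
    have "?h = (a, b, a \<oplus> c, b \<oplus> d)"
      using cl by (simp add: ge uni_lower_def)
    moreover have h: "?h \<in> carrier (SL2 R)"
      using g by simp
    ultimately have "P ?h"
      using main 2 by metis
    then have "P (uni_lower R (\<ominus> \<one>) \<otimes>\<^bsub>SL2 R\<^esub> ?h)"
      using low[of "\<ominus> \<one>" ?h] h by simp
    moreover have "uni_lower R (\<ominus> \<one>) \<otimes>\<^bsub>SL2 R\<^esub> ?h = g"
      using g by (simp add: S.m_assoc[symmetric] uni_lower_add l_neg)
        (simp add: uni_lower_def flip: SL2_one)
    ultimately show ?thesis by simp
  qed
qed

end

section \<open>Involutions among two by two matrices\<close>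

text \<open>
  The off-diagonal entries of \<open>A * A\<close> are multiples of the trace, so a nonzero trace makes \<open>A\<close> diagonal
  and then scalar.
\<close>

lemma involution_trace:
  assumes "A * A = (1::mat2)" and "A \<noteq> 1" and "A \<noteq> - 1"
  shows "tr A = 0"
proof -
  obtain a b c d where A: "A = Mat2 a b c d" by (cases A)
  have eq: "a * a + b * c = 1" "b * (a + d) = 0" "c * (a + d) = 0" "b * c + d * d = 1"
    using assms(1) by (simp_all add: A one_mat2_def algebra_simps)
  show ?thesis
  proof (rule ccontr)
    assume "tr A \<noteq> 0"
    then have ad: "a + d \<noteq> 0" by (simp add: A)
    then have bc: "b = 0" "c = 0" using eq by auto
    have "(a - d) * (a + d) = 0"
      using eq bc by (simp add: algebra_simps)
    then have d: "d = a" using ad by auto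
    have "a = 1 \<or> a = - 1"
      using eq(1) bc by (simp add: square_eq_1_iff)
    then show False
      using assms(2,3) bc d by (auto simp: A one_mat2_def)
  qed
qed

text \<open>
  The product of two commuting matrices of trace zero is scalar; for involutions that scalar is a
  sign.
\<close>

lemma commuting_involutions:
  assumes A: "A * A = (1::mat2)" "A \<noteq> 1" "A \<noteq> - 1" and B: "B * B = 1" and comm: "A * B = B * A"
  shows "B \<in> {1, - 1, A, - A}"
proof (cases "B = 1 \<or> B = - 1")
  case False
  have tr: "tr A = 0" "tr B = 0"
    using involution_trace A B False by auto
  obtain a b c d where Ae: "A = Mat2 a b c d" by (cases A)
  obtain e f g h where Be: "B = Mat2 e f g h" by (cases B)
  have d: "d = - a" "h = - e"
    using tr minus_unique[of a d] minus_unique[of e h] unfolding Ae Be by (metis tr.simps)+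
  have raw: "a * e + b * g = e * a + f * c" "a * f + b * h = e * b + f * d"
    "c * e + d * g = g * a + h * c"
    using comm by (auto simp: Ae Be)
  have eq: "a * f = b * e" "c * e = a * g" "b * g = c * f"
  proof -
    have "2 * (a * f - b * e) = (a * f + b * h) - (e * b + f * d)"
      "2 * (c * e - a * g) = (c * e + d * g) - (g * a + h * c)"
      unfolding d by (simp_all add: algebra_simps)
    then show "a * f = b * e" "c * e = a * g"
      using raw(2,3) by simp_all
    show "b * g = c * f"
      using raw(1) by (simp add: mult.commute)
  qed
  define s where "s = a * e + b * g"
  have AB: "A * B = Mat2 s 0 0 s"
    using eq unfolding Ae Be d s_def by (simp add: mult.commute)
  have "(A * B) * (A * B) = (A * B) * (B * A)"
    by (subst (2) comm) (rule refl)
  also have "\<dots> = A * (B * B) * A"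
    by (simp add: mult.assoc)
  also have "\<dots> = 1" using A B by simp
  finally have "s = 1 \<or> s = - 1"
    by (simp add: AB one_mat2_def square_eq_1_iff)
  then have "A * B = 1 \<or> A * B = - 1"
    by (auto simp: AB one_mat2_def)
  moreover have "B = A * (A * B)"
    using A by (simp flip: mult.assoc)
  ultimately show ?thesis by auto
qed auto

lemma anticommutator_traceless:
  assumes "tr A = 0" and "tr B = 0"
  shows "A * B + B * A = tr (A * B) \<bullet> 1"
proof -
  obtain a b c d where A: "A = Mat2 a b c d" by (cases A)
  obtain e f g h where B: "B = Mat2 e f g h" by (cases B)
  have "d = - a" "h = - e"
    using assms minus_unique[of a d] minus_unique[of e h] unfolding A B by (metis tr.simps)+
  then show ?thesis
    by (simp add: A B one_mat2_def algebra_simps)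
qed

text \<open>
  The three equations present the symmetric group on three letters, \<open>A\<close> and \<open>B\<close> being two
  transpositions.
\<close>

definition s3_pair :: "mat2 \<Rightarrow> mat2 \<Rightarrow> bool" where
  "s3_pair A B \<longleftrightarrow> A * A = 1 \<and> B * B = 1 \<and> A * B * A = B * A * B \<and> A * B \<noteq> B * A"

text \<open>
  For matrices of trace zero, \<open>A * B + B * A\<close> is the scalar \<open>s = tr (A * B)\<close>. Substituting this into the
  braid relation gives \<open>(s + 1) (A - B) = 0\<close>.
\<close>

lemma s3_pair_traces:
  assumes "s3_pair A B"
  shows "tr A = 0" "tr B = 0" "tr (A * B) = - 1"
proof -
  have AB: "A * A = 1" "B * B = 1" "A * B * A = B * A * B" "A * B \<noteq> B * A"
    using assms by (auto simp: s3_pair_def)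
  show tr: "tr A = 0" "tr B = 0"
    using AB by (auto intro!: involution_trace)
  let ?s = "tr (A * B)"
  have anti: "A * B = ?s \<bullet> 1 - B * A" "B * A = ?s \<bullet> 1 - A * B"
    using anticommutator_traceless[OF tr] by (simp_all add: algebra_simps)
  have "A * B * A = ?s \<bullet> A - B"
    by (subst anti(1)) (simp add: left_diff_distrib mult.assoc AB cscale_algebra)
  moreover have "B * A * B = ?s \<bullet> B - A"
    by (subst anti(2)) (simp add: left_diff_distrib mult.assoc AB cscale_algebra)
  ultimately have "?s \<bullet> A - B = ?s \<bullet> B - A"
    using AB by simp
  moreover have "(?s + 1) \<bullet> (A - B) = (?s \<bullet> A - B) - (?s \<bullet> B - A)"
    by (cases A; cases B) (simp add: algebra_simps)
  ultimately have "(?s + 1) \<bullet> (A - B) = 0" by simp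
  then have "?s + 1 = 0 \<or> A - B = 0"
    by (cases "A - B") (auto simp: zero_mat2_def)
  then have "?s = - 1 \<or> A = B"
    by (simp add: eq_neg_iff_add_eq_0)
  then show "?s = - 1"
    using AB by auto
qed

text \<open>
  The six elements of the symmetric group, evaluated at two pairs of transpositions at once: this
  compares two representations without an intertwining matrix.
\<close>

definition s3_words :: "mat2 \<Rightarrow> mat2 \<Rightarrow> mat2 \<Rightarrow> mat2 \<Rightarrow> (mat2 \<times> mat2) set" where
  "s3_words A B A' B' =
     {(1, 1), (A, A'), (B, B'), (A * B, A' * B'), (B * A, B' * A'), (A * B * A, A' * B' * A')}"

definition signed_s3_words :: "mat2 \<Rightarrow> mat2 \<Rightarrow> mat2 \<Rightarrow> mat2 \<Rightarrow> (mat2 \<times> mat2) set" where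
  "signed_s3_words A B A' B' = {(M, N). (M, N) \<in> s3_words A B A' B' \<or> (- M, - N) \<in> s3_words A B A' B'}"

lemma s3_words_closed:
  assumes "s3_pair A B" and "s3_pair A' B'" and "(M, N) \<in> s3_words A B A' B'"
  shows "(A * M, A' * N) \<in> s3_words A B A' B'" "(B * M, B' * N) \<in> s3_words A B A' B'"
proof -
  have rel: "A * A = 1" "B * B = 1" "B * (A * B) = A * (B * A)"
    "A' * A' = 1" "B' * B' = 1" "B' * (A' * B') = A' * (B' * A')"
    using assms(1,2) by (auto simp: s3_pair_def mult.assoc)
  have cancel: "A * (A * C) = C" "B * (B * C) = C" "A' * (A' * C) = C" "B' * (B' * C) = C"
    "B * (A * (B * C)) = A * (B * (A * C))" "B' * (A' * (B' * C)) = A' * (B' * (A' * C))" for C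
    using rel by (metis mult.assoc mult_1_left)+
  show "(A * M, A' * N) \<in> s3_words A B A' B'" "(B * M, B' * N) \<in> s3_words A B A' B'"
    using assms(3) by (auto simp: s3_words_def mult.assoc rel cancel)
qed

lemma signed_s3_words_closed:
  assumes "s3_pair A B" and "s3_pair A' B'" and "(M, N) \<in> signed_s3_words A B A' B'"
  shows "(A * M, A' * N) \<in> signed_s3_words A B A' B'" "(B * M, B' * N) \<in> signed_s3_words A B A' B'"
    "(- M, - N) \<in> signed_s3_words A B A' B'"
  using assms(3) s3_words_closed[OF assms(1,2), of M N] s3_words_closed[OF assms(1,2), of "- M" "- N"]
  by (auto simp: signed_s3_words_def)

lemma signed_s3_words_trace:
  assumes "s3_pair A B" and "s3_pair A' B'" and "(M, N) \<in> signed_s3_words A B A' B'"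
  shows "tr M = tr N"
proof -
  have traces: "tr A = 0" "tr B = 0" "tr (A * B) = - 1" "tr (B * A) = - 1" "tr (A * B * A) = 0"
    if "s3_pair A B" for A B
  proof -
    show "tr A = 0" "tr B = 0" "tr (A * B) = - 1" "tr (B * A) = - 1"
      using s3_pair_traces[OF that] tr_commute[of B A] by simp_all
    have "A * (A * B) = B"
      using that by (simp add: s3_pair_def flip: mult.assoc)
    then show "tr (A * B * A) = 0"
      using tr_commute[of "A * B" A] s3_pair_traces[OF that] by simp
  qed
  have words: "tr M = tr N" if "(M, N) \<in> s3_words A B A' B'" for M N
    using that traces[OF assms(1)] traces[OF assms(2)] unfolding s3_words_def by (elim insertE) simp_all
  show ?thesis
    using assms(3) words[of M N] words[of "- M" "- N"] by (auto simp: signed_s3_words_def)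
qed

section \<open>Two-dimensional representations in characteristic two\<close>

text \<open>
  The properties of \<open>\<F>\<^sub>2[t]/(t\<^sup>k)\<close> on which the argument rests; the last one says that \<open>t\<close> generates
  an ideal with residue field of two elements.
\<close>

locale char2_uniserial = cring R for R (structure) +
  fixes t
  assumes char2: "\<one> \<oplus> \<one> = \<zero>" and nontrivial: "\<one> \<noteq> \<zero>" and t_closed [simp]: "t \<in> carrier R"
    and nilpotent: "\<exists>n::nat. t [^] n = \<zero>"
    and residue: "x \<in> carrier R \<Longrightarrow> \<exists>r\<in>carrier R. x = t \<otimes> r \<or> x = \<one> \<oplus> t \<otimes> r"
begin

lemma add_self: "x \<in> carrier R \<Longrightarrow> x \<oplus> x = \<zero>"
proof -
  assume x: "x \<in> carrier R"
  then have "x \<oplus> x = (\<one> \<oplus> \<one>) \<otimes> x" by algebra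
  then show ?thesis using x by (simp add: char2)
qed

lemma neg_self: "x \<in> carrier R \<Longrightarrow> \<ominus> x = x"
  by (simp add: add_self minus_equality)

lemma minus_add: "x \<in> carrier R \<Longrightarrow> y \<in> carrier R \<Longrightarrow> x \<ominus> y = x \<oplus> y"
  by (simp add: a_minus_def neg_self)

text \<open>
  An inverse modulo \<open>t\<^sup>n\<close> is corrected to one modulo \<open>t\<close> to the power \<open>n + 1\<close>, until the power of
  \<open>t\<close> vanishes.
\<close>

lemma one_plus_inverse:
  assumes r: "r \<in> carrier R"
  obtains v where "v \<in> carrier R" "(\<one> \<oplus> t \<otimes> r) \<otimes> v = \<one>"
proof -
  have "\<exists>v\<in>carrier R. \<exists>s\<in>carrier R. (\<one> \<oplus> t \<otimes> r) \<otimes> v = \<one> \<oplus> t [^] n \<otimes> s" for n :: nat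
  proof (induction n)
    case 0
    \<comment> \<open>Modulo \<open>1\<close> anything is an inverse; \<open>0\<close> will do because \<open>1 + 1 = 0\<close>.\<close>
    have "(\<one> \<oplus> t \<otimes> r) \<otimes> \<zero> = \<one> \<oplus> t [^] (0::nat) \<otimes> \<one>"
      using r by (simp add: char2)
    then show ?case by blast
  next
    case (Suc n)
    then obtain v s where v: "v \<in> carrier R" "s \<in> carrier R"
      "(\<one> \<oplus> t \<otimes> r) \<otimes> v = \<one> \<oplus> t [^] n \<otimes> s" by blast
    let ?v = "v \<ominus> t [^] n \<otimes> s" and ?s = "\<ominus> (r \<otimes> s)"
    have tn: "t [^] n \<in> carrier R" by simp
    have "(\<one> \<oplus> t \<otimes> r) \<otimes> ?v
        = (\<one> \<oplus> t \<otimes> r) \<otimes> v \<ominus> (\<one> \<oplus> t \<otimes> r) \<otimes> (t [^] n \<otimes> s)"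
      using v(1,2) r tn t_closed by algebra
    also have "\<dots> = \<one> \<oplus> (t [^] n \<otimes> t) \<otimes> ?s"
      unfolding v(3) using v(1,2) r tn t_closed by algebra
    finally have "(\<one> \<oplus> t \<otimes> r) \<otimes> ?v = \<one> \<oplus> t [^] Suc n \<otimes> ?s" by simp
    then show ?case using v r by (intro bexI[of _ ?v] bexI[of _ ?s]) auto
  qed
  moreover obtain n :: nat where "t [^] n = \<zero>"
    using nilpotent by blast
  ultimately have "\<exists>v\<in>carrier R. (\<one> \<oplus> t \<otimes> r) \<otimes> v = \<one>"
    by (metis l_null r_zero one_closed)
  then show thesis using that by blast
qed

lemma one_plus_Unit: "r \<in> carrier R \<Longrightarrow> \<one> \<oplus> t \<otimes> r \<in> Units R"
  using one_plus_inverse[of r] unfolding Units_def by (auto simp: m_comm)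

lemma t_mult_neq_one: "r \<in> carrier R \<Longrightarrow> t \<otimes> r \<noteq> \<one>"
proof
  assume r: "r \<in> carrier R" and "t \<otimes> r = \<one>"
  then have "\<zero> \<in> Units R"
    using one_plus_Unit[OF r] by (simp add: char2)
  then show False
    using nontrivial by (auto simp: Units_def)
qed

lemma SL2_unit_in_column:
  assumes "(a, b, c, d) \<in> carrier (SL2 R)"
  shows "c \<in> Units R \<or> a \<oplus> c \<in> Units R"
proof -
  have cl: "a \<in> carrier R" "b \<in> carrier R" "c \<in> carrier R" "d \<in> carrier R"
    and det: "a \<otimes> d \<ominus> b \<otimes> c = \<one>"
    using assms by (auto simp: SL2_carrier)
  obtain r where r: "r \<in> carrier R" "a = t \<otimes> r \<or> a = \<one> \<oplus> t \<otimes> r"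
    using residue cl by blast
  obtain s where s: "s \<in> carrier R" "c = t \<otimes> s \<or> c = \<one> \<oplus> t \<otimes> s"
    using residue cl by blast
  consider "c = \<one> \<oplus> t \<otimes> s" | "c = t \<otimes> s" "a = \<one> \<oplus> t \<otimes> r" | "c = t \<otimes> s" "a = t \<otimes> r"
    using r s by blast
  then show ?thesis
  proof cases
    case 1
    then show ?thesis using one_plus_Unit s by blast
  next
    case 2
    then have "a \<oplus> c = \<one> \<oplus> t \<otimes> (r \<oplus> s)"
      using r(1) s(1) t_closed by (simp, algebra)
    then show ?thesis using one_plus_Unit r s by simp
  next
    case 3
    then have "a \<otimes> d \<ominus> b \<otimes> c = t \<otimes> (r \<otimes> d \<ominus> b \<otimes> s)"
      using r(1) s(1) cl t_closed by (simp, algebra)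
    then show ?thesis
      using t_mult_neq_one[of "r \<otimes> d \<ominus> b \<otimes> s"] det r s cl by simp
  qed
qed

lemmas SL2_induct = SL2_elementary_induct[OF _ SL2_unit_in_column]

text \<open>
  The ideal generated by a power of \<open>t\<close> is the union of two translates of the next one.
\<close>

lemma finite_carrier: "finite (carrier R)"
proof -
  let ?I = "\<lambda>n::nat. (\<lambda>r. t [^] n \<otimes> r) ` carrier R"
  obtain N :: nat where N: "t [^] N = \<zero>"
    using nilpotent by blast
  have step: "?I n \<subseteq> ?I (Suc n) \<union> (\<lambda>y. t [^] n \<oplus> y) ` ?I (Suc n)" for n
  proof
    fix y assume "y \<in> ?I n"
    then obtain x where x: "x \<in> carrier R" "y = t [^] n \<otimes> x" by blast
    obtain r where r: "r \<in> carrier R" "x = t \<otimes> r \<or> x = \<one> \<oplus> t \<otimes> r"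
      using residue x by blast
    have "y = t [^] Suc n \<otimes> r \<or> y = t [^] n \<oplus> t [^] Suc n \<otimes> r"
      using r by (auto simp: x(2) m_assoc r_distr)
    then show "y \<in> ?I (Suc n) \<union> (\<lambda>y. t [^] n \<oplus> y) ` ?I (Suc n)"
      using r(1) by blast
  qed
  have "?I N \<subseteq> {\<zero>}" using N by auto
  then have "finite (?I N)" by (rule finite_subset) simp
  then have "finite (?I 0)"
    by (rule inc_induct[of 0 N, rotated]) (use finite_subset[OF step] in auto)
  moreover have "?I 0 = carrier R" by (auto simp: image_iff)
  ultimately show ?thesis by simp
qed

lemma finite_SL2: "finite (carrier (SL2 R))"
proof (rule finite_subset)
  show "carrier (SL2 R) \<subseteq> carrier R \<times> carrier R \<times> carrier R \<times> carrier R"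
    by (auto simp: SL2_def)
qed (use finite_carrier in auto)

end

text \<open>
  The absence of commutativity replaces irreducibility: it passes through an isomorphism of group
  algebras directly.
\<close>

locale noncommuting_rep = char2_uniserial +
  fixes \<sigma> :: "'a \<times> 'a \<times> 'a \<times> 'a \<Rightarrow> mat2"
  assumes rep: "rep2 (SL2 R) \<sigma>" and noncommuting: "\<not> commuting_on (carrier (SL2 R)) \<sigma>"
begin

abbreviation "u x \<equiv> \<sigma> (uni_upper R x)"
abbreviation "l x \<equiv> \<sigma> (uni_lower R x)"

sublocale S: group "SL2 R" by (rule SL2_group)

lemma rep_mult: "g \<in> carrier (SL2 R) \<Longrightarrow> h \<in> carrier (SL2 R) \<Longrightarrow> \<sigma> (g \<otimes>\<^bsub>SL2 R\<^esub> h) = \<sigma> g * \<sigma> h"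
  using rep by (simp add: rep2_def)

lemma rep_one: "\<sigma> \<one>\<^bsub>SL2 R\<^esub> = 1"
  using rep by (simp add: rep2_def)

lemma u_add: "x \<in> carrier R \<Longrightarrow> y \<in> carrier R \<Longrightarrow> u (x \<oplus> y) = u x * u y"
  by (simp add: uni_upper_add flip: rep_mult)

lemma l_add: "x \<in> carrier R \<Longrightarrow> y \<in> carrier R \<Longrightarrow> l (x \<oplus> y) = l x * l y"
  by (simp add: uni_lower_add flip: rep_mult)

lemma u_zero: "u \<zero> = 1" and l_zero: "l \<zero> = 1"
  using rep_one by (simp_all add: uni_upper_def uni_lower_def SL2_one)

lemma u_involution: "x \<in> carrier R \<Longrightarrow> u x * u x = 1"
  by (simp add: add_self u_zero flip: u_add)

lemma l_involution: "x \<in> carrier R \<Longrightarrow> l x * l x = 1"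
  by (simp add: add_self l_zero flip: l_add)

lemma u_commute: "x \<in> carrier R \<Longrightarrow> y \<in> carrier R \<Longrightarrow> u x * u y = u y * u x"
  by (simp add: a_comm flip: u_add)

text \<open>
  In characteristic two the Weyl element \<open>(0, 1, 1, 0)\<close> has determinant one and order two, and
  it exchanges the upper and the lower unipotent matrices. Its image is \<open>\<omega>\<close>.
\<close>

definition \<tau> :: mat2 where "\<tau> = u \<one>"
definition \<tau>' :: mat2 where "\<tau>' = l \<one>"
definition \<omega> :: mat2 where "\<omega> = \<sigma> (\<zero>, \<one>, \<one>, \<zero>)"

lemma swap_closed: "(\<zero>, \<one>, \<one>, \<zero>) \<in> carrier (SL2 R)"
  by (simp add: SL2_carrier minus_add)

lemma swap_word: "\<omega> = \<tau> * \<tau>' * \<tau>" "\<omega> = \<tau>' * \<tau> * \<tau>'"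
proof -
  have "(\<zero>, \<one>, \<one>, \<zero>) = uni_upper R \<one> \<otimes>\<^bsub>SL2 R\<^esub> uni_lower R \<one> \<otimes>\<^bsub>SL2 R\<^esub> uni_upper R \<one>"
    by (simp add: uni_upper_def uni_lower_def char2)
  then show "\<omega> = \<tau> * \<tau>' * \<tau>"
    by (simp only: \<omega>_def \<tau>_def \<tau>'_def rep_mult S.m_closed uni_upper_closed uni_lower_closed one_closed)
  have "(\<zero>, \<one>, \<one>, \<zero>) = uni_lower R \<one> \<otimes>\<^bsub>SL2 R\<^esub> uni_upper R \<one> \<otimes>\<^bsub>SL2 R\<^esub> uni_lower R \<one>"
    by (simp add: uni_upper_def uni_lower_def char2)
  then show "\<omega> = \<tau>' * \<tau> * \<tau>'"
    by (simp only: \<omega>_def \<tau>_def \<tau>'_def rep_mult S.m_closed uni_upper_closed uni_lower_closed one_closed)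
qed

lemma tau_involution: "\<tau> * \<tau> = 1" "\<tau>' * \<tau>' = 1"
  by (simp_all add: \<tau>_def \<tau>'_def u_involution l_involution)

lemma swap_conj: "x \<in> carrier R \<Longrightarrow> \<omega> * u x * \<omega> = l x"
proof -
  assume x: "x \<in> carrier R"
  have "(\<zero>, \<one>, \<one>, \<zero>) \<otimes>\<^bsub>SL2 R\<^esub> uni_upper R x \<otimes>\<^bsub>SL2 R\<^esub> (\<zero>, \<one>, \<one>, \<zero>) = uni_lower R x"
    using x by (simp add: uni_upper_def uni_lower_def)
  from this[symmetric] show ?thesis
    using x swap_closed by (simp only: \<omega>_def rep_mult S.m_closed uni_upper_closed)
qed

lemma swap_involution: "\<omega> * \<omega> = 1"
proof -
  have "(\<zero>, \<one>, \<one>, \<zero>) \<otimes>\<^bsub>SL2 R\<^esub> (\<zero>, \<one>, \<one>, \<zero>) = \<one>\<^bsub>SL2 R\<^esub>"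
    by (simp add: SL2_one)
  then show ?thesis
    using swap_closed rep_one by (simp add: \<omega>_def flip: rep_mult)
qed

text \<open>
  If \<open>\<tau>\<close> and \<open>\<tau>'\<close> commuted, the two words for \<open>\<omega>\<close> would give \<open>\<omega> = \<tau>\<close>. As \<open>\<tau>\<close> commutes with every \<open>u x\<close>,
  conjugation by \<open>\<omega>\<close> would then identify \<open>l x\<close> with \<open>u x\<close>, and a commutative set of matrices would
  generate the whole image.
\<close>

lemma tau_noncommuting: "\<tau> * \<tau>' \<noteq> \<tau>' * \<tau>"
proof
  assume comm: "\<tau> * \<tau>' = \<tau>' * \<tau>"
  have "\<tau>' * \<tau> * \<tau>' = \<tau> * (\<tau>' * \<tau>')"
    by (simp only: comm[symmetric] mult.assoc)
  also have "\<dots> = \<tau>"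
    by (simp add: tau_involution)
  finally have eq: "\<omega> = \<tau>"
    using swap_word by simp
  have lu: "l x = u x" if x: "x \<in> carrier R" for x
  proof -
    have "l x = \<tau> * (u x * \<tau>)"
      using swap_conj[OF x] by (simp add: eq mult.assoc)
    also have "u x * \<tau> = \<tau> * u x"
      using x by (simp add: \<tau>_def u_commute)
    also have "\<tau> * (\<tau> * u x) = u x"
      by (simp add: tau_involution flip: mult.assoc)
    finally show ?thesis .
  qed
  have left: "\<sigma> g * u x = u x * \<sigma> g" if g: "g \<in> carrier (SL2 R)" and x: "x \<in> carrier R" for g x
    using g
  proof (rule SL2_induct)
    show "\<sigma> \<one>\<^bsub>SL2 R\<^esub> * u x = u x * \<sigma> \<one>\<^bsub>SL2 R\<^esub>"
      by (simp add: rep_one)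
  next
    fix y g assume y: "y \<in> carrier R" and g: "g \<in> carrier (SL2 R)" and IH: "\<sigma> g * u x = u x * \<sigma> g"
    have "u y * \<sigma> g * u x = u x * (u y * \<sigma> g)"
      using IH u_commute[OF x y] by (metis mult.assoc)
    then show "\<sigma> (uni_upper R y \<otimes>\<^bsub>SL2 R\<^esub> g) * u x = u x * \<sigma> (uni_upper R y \<otimes>\<^bsub>SL2 R\<^esub> g)"
      "\<sigma> (uni_lower R y \<otimes>\<^bsub>SL2 R\<^esub> g) * u x = u x * \<sigma> (uni_lower R y \<otimes>\<^bsub>SL2 R\<^esub> g)"
      using y g by (simp_all add: rep_mult lu)
  qed
  have "\<sigma> h * \<sigma> g = \<sigma> g * \<sigma> h" if g: "g \<in> carrier (SL2 R)" and h: "h \<in> carrier (SL2 R)" for g h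
    using h
  proof (rule SL2_induct)
    show "\<sigma> \<one>\<^bsub>SL2 R\<^esub> * \<sigma> g = \<sigma> g * \<sigma> \<one>\<^bsub>SL2 R\<^esub>"
      by (simp add: rep_one)
  next
    fix y h assume y: "y \<in> carrier R" and h: "h \<in> carrier (SL2 R)" and IH: "\<sigma> h * \<sigma> g = \<sigma> g * \<sigma> h"
    have "u y * \<sigma> h * \<sigma> g = \<sigma> g * (u y * \<sigma> h)"
      using IH left[OF g y] by (metis mult.assoc)
    then show "\<sigma> (uni_upper R y \<otimes>\<^bsub>SL2 R\<^esub> h) * \<sigma> g = \<sigma> g * \<sigma> (uni_upper R y \<otimes>\<^bsub>SL2 R\<^esub> h)"
      "\<sigma> (uni_lower R y \<otimes>\<^bsub>SL2 R\<^esub> h) * \<sigma> g = \<sigma> g * \<sigma> (uni_lower R y \<otimes>\<^bsub>SL2 R\<^esub> h)"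
      using y h by (simp_all add: rep_mult lu)
  qed
  then show False
    using noncommuting by (auto simp: commuting_on_def)
qed

lemma tau_s3_pair: "s3_pair \<tau> \<tau>'"
  using tau_involution tau_noncommuting swap_word by (simp add: s3_pair_def)

lemma tau_nonscalar: "\<tau> \<noteq> 1" "\<tau> \<noteq> - 1" "- \<tau> \<noteq> 1"
proof -
  show "\<tau> \<noteq> 1" and neg: "\<tau> \<noteq> - 1"
    using tau_noncommuting by auto
  show "- \<tau> \<noteq> 1"
  proof
    assume "- \<tau> = 1"
    then have "- (- \<tau>) = - 1" by (simp only:)
    then show False using neg by simp
  qed
qed

lemma u_values: "x \<in> carrier R \<Longrightarrow> u x \<in> {1, - 1, \<tau>, - \<tau>}"
  using commuting_involutions[OF tau_involution(1) tau_nonscalar(1,2), of "u x"] u_involution u_commute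
  by (simp add: \<tau>_def)

lemma l_eq_u_if_scalar: "x \<in> carrier R \<Longrightarrow> u x \<in> {1, - 1} \<Longrightarrow> l x = u x"
  using swap_conj[of x] swap_involution by auto

lemma l_eq_if_tau: "x \<in> carrier R \<Longrightarrow> u x = \<tau> \<Longrightarrow> l x = \<tau>'" "x \<in> carrier R \<Longrightarrow> u x = - \<tau> \<Longrightarrow> l x = - \<tau>'"
  using swap_conj[of x] swap_conj[of \<one>] by (auto simp: \<tau>_def \<tau>'_def)

text \<open>
  Let \<open>v\<close> be the inverse of \<open>1 + t\<close> and \<open>\<Delta>\<close> the image of the diagonal matrix \<open>D\<close> with entries \<open>1 + t\<close> and
  \<open>v\<close>. Conjugation by \<open>D\<close> takes \<open>U(x)\<close> to \<open>U(x) U(t\<^sup>2 x)\<close>. As conjugation cannot change whether an element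
  of \<open>{\<plusminus>1, \<plusminus>\<tau>}\<close> is scalar, \<open>U(t\<^sup>2 x)\<close> acts as a sign. The factorization
  \<open>U(1) L(t) = L(t v) D U(v)\<close> then determines \<open>\<Delta>\<close>. If \<open>U(t)\<close> acted as \<open>\<plusminus>\<tau>\<close>, then \<open>\<Delta>\<close> would be
  \<open>\<plusminus>\<tau> \<tau>' \<tau>\<close>, which does not commute with \<open>\<tau>\<close> even up to sign. So \<open>U(t)\<close> acts as a sign, \<open>\<Delta>\<close> is the
  same sign, and conjugation by it is trivial.
\<close>

lemma u_t_scalar: "u t \<in> {1, - 1}"
  and u_square: "x \<in> carrier R \<Longrightarrow> u (t \<otimes> t \<otimes> x) = 1"
proof -
  obtain v where v: "v \<in> carrier R" "(\<one> \<oplus> t) \<otimes> v = \<one>"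
    using one_plus_inverse[of \<one>] by auto
  define D where "D = (\<one> \<oplus> t, \<zero>, \<zero>, v)"
  define D' where "D' = (v, \<zero>, \<zero>, \<one> \<oplus> t)"
  have D: "D \<in> carrier (SL2 R)" "D' \<in> carrier (SL2 R)" "D' \<otimes>\<^bsub>SL2 R\<^esub> D = \<one>\<^bsub>SL2 R\<^esub>"
    "D \<otimes>\<^bsub>SL2 R\<^esub> D' = \<one>\<^bsub>SL2 R\<^esub>"
    using v by (simp_all add: D_def D'_def SL2_carrier SL2_one minus_add m_comm[of v])
  define \<Delta> where "\<Delta> = \<sigma> D"
  define \<Delta>' where "\<Delta>' = \<sigma> D'"
  have \<Delta>_inv: "\<Delta>' * \<Delta> = 1" "\<Delta> * \<Delta>' = 1"
    using D rep_one by (simp_all add: \<Delta>_def \<Delta>'_def flip: rep_mult)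
  have conj: "\<Delta> * u x = u x * u (t \<otimes> t \<otimes> x) * \<Delta>" if x: "x \<in> carrier R" for x
  proof -
    have "(x \<oplus> t \<otimes> t \<otimes> x) \<otimes> v = (\<one> \<oplus> t) \<otimes> x \<otimes> ((\<one> \<oplus> t) \<otimes> v) \<ominus> ((\<one> \<oplus> \<one>) \<otimes> t) \<otimes> (x \<otimes> v)"
      using x v(1) t_closed by algebra
    also have "\<dots> = (\<one> \<oplus> t) \<otimes> x"
      unfolding v(2) char2 using x v(1) t_closed by algebra
    finally have "D \<otimes>\<^bsub>SL2 R\<^esub> uni_upper R x
        = uni_upper R (x \<oplus> t \<otimes> t \<otimes> x) \<otimes>\<^bsub>SL2 R\<^esub> D"
      using x v(1) by (simp add: D_def uni_upper_def)
    then show ?thesis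
      using D x unfolding \<Delta>_def by (metis rep_mult uni_upper_closed u_add m_closed a_closed t_closed)
  qed
  have v_eq: "v = \<one> \<oplus> t \<otimes> v"
  proof -
    have "v = (\<one> \<oplus> t) \<otimes> v \<ominus> t \<otimes> v" using v(1) t_closed by algebra
    then show ?thesis using v by (simp add: minus_add)
  qed
  \<comment> \<open>Modulo \<open>t\<^sup>2\<close>, where \<open>U\<close> acts through signs, \<open>t v\<close> is \<open>t\<close>.\<close>
  have tv_eq: "t \<otimes> v = t \<oplus> t \<otimes> t \<otimes> v"
  proof -
    have "t \<otimes> v = t \<otimes> ((\<one> \<oplus> t) \<otimes> v) \<ominus> t \<otimes> t \<otimes> v" using v(1) t_closed by algebra
    then show ?thesis using v by (simp add: minus_add)
  qed
  have factor: "\<tau> * l t = l (t \<otimes> v) * \<Delta> * u v"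
  proof -
    have "t \<otimes> v \<oplus> v = \<one>"
      using v by (simp add: l_distr a_comm)
    then have "uni_upper R \<one> \<otimes>\<^bsub>SL2 R\<^esub> uni_lower R t
        = uni_lower R (t \<otimes> v) \<otimes>\<^bsub>SL2 R\<^esub> D \<otimes>\<^bsub>SL2 R\<^esub> uni_upper R v"
      using v by (simp add: D_def uni_upper_def uni_lower_def m_assoc m_comm[of v])
    then show ?thesis
      using D v unfolding \<Delta>_def \<tau>_def
      by (metis rep_mult uni_upper_closed uni_lower_closed one_closed S.m_closed m_closed t_closed)
  qed
  have square_scalar: "u (t \<otimes> t \<otimes> x) \<in> {1, - 1}" if x: "x \<in> carrier R" for x
  proof (rule ccontr)
    assume "u (t \<otimes> t \<otimes> x) \<notin> {1, - 1}"
    then have sq: "u (t \<otimes> t \<otimes> x) \<in> {\<tau>, - \<tau>}"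
      using u_values[of "t \<otimes> t \<otimes> x"] x by auto
    have inv: "\<Delta>' * (\<Delta> * M) = M" for M
      using \<Delta>_inv(1) by (simp flip: mult.assoc)
    have inv': "M * \<Delta> * \<Delta>' = M" for M
      using \<Delta>_inv(2) by (simp add: mult.assoc)
    consider "u x \<in> {1, - 1}" | "u x \<in> {\<tau>, - \<tau>}"
      using u_values[OF x] by auto
    then show False
    proof cases
      case 1
      then have "\<Delta> = u (t \<otimes> t \<otimes> x) * \<Delta>"
        using conj[OF x] by auto
      then have "u (t \<otimes> t \<otimes> x) = 1"
        using inv'[of 1] inv'[of "u (t \<otimes> t \<otimes> x)"] by simp
      then show False
        using sq tau_nonscalar by auto
    next
      case 2
      then have "u x * u (t \<otimes> t \<otimes> x) \<in> {1, - 1}"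
        using sq tau_involution by auto
      then have "\<Delta> * u x = \<Delta> \<or> \<Delta> * u x = - \<Delta>"
        using conj[OF x] by (elim insertE) simp_all
      then have "\<Delta>' * (\<Delta> * u x) = \<Delta>' * \<Delta> \<or> \<Delta>' * (\<Delta> * u x) = \<Delta>' * (- \<Delta>)"
        by metis
      then have "u x = 1 \<or> u x = - 1"
        by (simp add: inv \<Delta>_inv)
      then show False
        using 2 tau_nonscalar by (elim insertE emptyE disjE) simp_all
    qed
  qed
  define q where "q = u (t \<otimes> t \<otimes> v)"
  have q: "q \<in> {1, - 1}" "l (t \<otimes> t \<otimes> v) = q"
    using square_scalar[OF v(1)] l_eq_u_if_scalar[of "t \<otimes> t \<otimes> v"] v by (auto simp: q_def)
  have uv: "u (t \<otimes> v) = u t * q" "l (t \<otimes> v) = l t * q"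
    using u_add[of t "t \<otimes> t \<otimes> v"] l_add[of t "t \<otimes> t \<otimes> v"] v q(2) tv_eq by (simp_all add: q_def)
  then have uv1: "u v = \<tau> * (u t * q)"
    using u_add[of \<one> "t \<otimes> v"] v v_eq by (simp add: \<tau>_def)
  show t_scalar: "u t \<in> {1, - 1}"
  proof (rule ccontr)
    assume "u t \<notin> {1, - 1}"
    then have cases: "u t = \<tau> \<and> l t = \<tau>' \<or> u t = - \<tau> \<and> l t = - \<tau>'"
      using u_values[of t] l_eq_if_tau[of t] by auto
    then have "\<tau>' * \<Delta> = \<tau> * \<tau>' \<or> \<tau>' * \<Delta> = - (\<tau> * \<tau>')"
      using factor q(1) tau_involution by (auto simp: uv uv1)
    then have "\<tau>' * (\<tau>' * \<Delta>) = \<tau>' * (\<tau> * \<tau>') \<or> \<tau>' * (\<tau>' * \<Delta>) = - (\<tau>' * (\<tau> * \<tau>'))"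
      by auto
    moreover have "\<tau>' * (\<tau>' * \<Delta>) = \<Delta>"
      using tau_involution by (simp flip: mult.assoc)
    moreover have "\<tau>' * (\<tau> * \<tau>') = \<tau> * \<tau>' * \<tau>"
      using swap_word by (simp add: mult.assoc)
    ultimately have \<Delta>: "\<Delta> \<in> {\<tau> * \<tau>' * \<tau>, - (\<tau> * \<tau>' * \<tau>)}"
      by auto
    have "\<Delta> * \<tau> = \<tau> * \<Delta> \<or> \<Delta> * \<tau> = - (\<tau> * \<Delta>)"
      using conj[of \<one>] square_scalar[of \<one>] by (auto simp: \<tau>_def)
    then have "\<tau> * \<tau>' * \<tau> * \<tau> = \<tau> * (\<tau> * \<tau>' * \<tau>) \<or> \<tau> * \<tau>' * \<tau> * \<tau> = - (\<tau> * (\<tau> * \<tau>' * \<tau>))"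
      using \<Delta> by (auto simp: minus_equation_iff[of "\<tau> * \<tau>' * \<tau> * \<tau>"])
    moreover have "\<tau> * \<tau>' * \<tau> * \<tau> = \<tau> * \<tau>'"
      using tau_involution by (simp add: mult.assoc)
    moreover have "\<tau> * (\<tau> * \<tau>' * \<tau>) = \<tau>' * \<tau>"
      using tau_involution by (simp flip: mult.assoc)
    \<comment> \<open>Anticommuting matrices have product of trace \<open>0\<close>, but here the trace is \<open>-1\<close>.\<close>
    ultimately have "\<tau> * \<tau>' = - (\<tau>' * \<tau>)"
      using tau_noncommuting by simp
    then have "tr (\<tau> * \<tau>') = - tr (\<tau> * \<tau>')"
      using tr_commute[of \<tau> \<tau>'] by (metis tr_linear(2))
    then show False
      using s3_pair_traces(3)[OF tau_s3_pair] by simp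
  qed
  have "l t = u t"
    using l_eq_u_if_scalar t_scalar by simp
  then have "l (t \<otimes> v) * \<Delta> * u v = \<Delta> * \<tau>"
    using q(1) t_scalar unfolding uv(2) uv1 by auto
  then have "\<Delta> * \<tau> = \<tau> * u t"
    using factor \<open>l t = u t\<close> by simp
  then have "\<Delta> * (\<tau> * \<tau>) = \<tau> * u t * \<tau>"
    by (simp flip: mult.assoc)
  then have \<Delta>: "\<Delta> = u t"
    using t_scalar tau_involution by auto
  show "u (t \<otimes> t \<otimes> x) = 1" if x: "x \<in> carrier R" for x
  proof -
    have "u x * u (t \<otimes> t \<otimes> x) = u x"
      using conj[OF x] t_scalar by (auto simp: \<Delta>)
    then have "u x * u x * u (t \<otimes> t \<otimes> x) = u x * u x"
      by (simp add: mult.assoc)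
    then show ?thesis
      using u_involution[OF x] by simp
  qed
qed

lemma u_decomposition:
  assumes x: "x \<in> carrier R"
  shows "\<exists>i j. i \<in> {\<zero>, \<one>} \<and> j \<in> {\<zero>, \<one>} \<and> (\<exists>r\<in>carrier R. x = i \<oplus> (t \<otimes> j \<oplus> t \<otimes> t \<otimes> r))"
proof -
  have split: "\<exists>i\<in>{\<zero>, \<one>}. \<exists>r\<in>carrier R. x = i \<oplus> t \<otimes> r" if "x \<in> carrier R" for x
    using residue[OF that] by auto
  obtain i y where i: "i \<in> {\<zero>, \<one>}" "y \<in> carrier R" "x = i \<oplus> t \<otimes> y"
    using split x by blast
  obtain j r where j: "j \<in> {\<zero>, \<one>}" "r \<in> carrier R" "y = j \<oplus> t \<otimes> r"
    using split i(2) by blast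
  have "x = i \<oplus> (t \<otimes> j \<oplus> t \<otimes> t \<otimes> r)"
    using i j by (auto simp: r_distr m_assoc)
  then show ?thesis using i j by blast
qed

end

text \<open>
  Both representations send each elementary matrix to the same signed word in their own \<open>\<tau>\<close> and
  \<open>\<tau>'\<close>. Hence every group element has this property, and the trace of a signed word is the same for all
  pairs of transpositions.
\<close>

lemma (in char2_uniserial) character_determined:
  assumes \<phi>: "noncommuting_rep R t \<phi>" and \<psi>: "noncommuting_rep R t \<psi>"
    and eq: "\<phi> (uni_upper R t) = \<psi> (uni_upper R t)" and g: "g \<in> carrier (SL2 R)"
  shows "tr (\<phi> g) = tr (\<psi> g)"
proof -
  interpret \<phi>: noncommuting_rep R t \<phi> by (rule \<phi>)
  interpret \<psi>: noncommuting_rep R t \<psi> by (rule \<psi>)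
  let ?W = "signed_s3_words \<phi>.\<tau> \<phi>.\<tau>' \<psi>.\<tau> \<psi>.\<tau>'"
  note closed = signed_s3_words_closed[OF \<phi>.tau_s3_pair \<psi>.tau_s3_pair]
  have cases: "\<exists>e\<in>{1, - 1}. \<phi>.u x = e \<and> \<psi>.u x = e \<or> \<phi>.u x = e * \<phi>.\<tau> \<and> \<psi>.u x = e * \<psi>.\<tau>"
    if x: "x \<in> carrier R" for x
  proof -
    obtain i j r where d: "i \<in> {\<zero>, \<one>}" "j \<in> {\<zero>, \<one>}" "r \<in> carrier R"
      "x = i \<oplus> (t \<otimes> j \<oplus> t \<otimes> t \<otimes> r)"
      using \<phi>.u_decomposition[OF x] by blast
    have "\<phi>.u x = \<phi>.u i * \<phi>.u (t \<otimes> j)" "\<psi>.u x = \<psi>.u i * \<psi>.u (t \<otimes> j)"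
      using d by (auto simp: \<phi>.u_add \<psi>.u_add \<phi>.u_square \<psi>.u_square \<phi>.u_zero \<psi>.u_zero)
    then show ?thesis
      using d(1,2) \<phi>.u_t_scalar eq by (auto simp: \<phi>.u_zero \<psi>.u_zero \<phi>.\<tau>_def \<psi>.\<tau>_def)
  qed
  have "(\<phi> g, \<psi> g) \<in> ?W"
    using g
  proof (rule SL2_induct)
    show "(\<phi> \<one>\<^bsub>SL2 R\<^esub>, \<psi> \<one>\<^bsub>SL2 R\<^esub>) \<in> ?W"
      by (simp add: \<phi>.rep_one \<psi>.rep_one signed_s3_words_def s3_words_def)
  next
    fix x g assume x: "x \<in> carrier R" and g: "g \<in> carrier (SL2 R)" and IH: "(\<phi> g, \<psi> g) \<in> ?W"
    obtain e where e: "e \<in> {1, - 1}"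
      "\<phi>.u x = e \<and> \<psi>.u x = e \<or> \<phi>.u x = e * \<phi>.\<tau> \<and> \<psi>.u x = e * \<psi>.\<tau>"
      using cases[OF x] by blast
    have "(\<phi>.u x * \<phi> g, \<psi>.u x * \<psi> g) \<in> ?W"
      using e IH closed[OF IH] closed(3)[OF closed(1)[OF IH]] by (elim insertE disjE emptyE) simp_all
    then show "(\<phi> (uni_upper R x \<otimes>\<^bsub>SL2 R\<^esub> g), \<psi> (uni_upper R x \<otimes>\<^bsub>SL2 R\<^esub> g)) \<in> ?W"
      using x g by (simp add: \<phi>.rep_mult \<psi>.rep_mult)
    have "\<phi>.l x = e \<and> \<psi>.l x = e \<or> \<phi>.l x = e * \<phi>.\<tau>' \<and> \<psi>.l x = e * \<psi>.\<tau>'"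
      using e \<phi>.l_eq_u_if_scalar[OF x] \<psi>.l_eq_u_if_scalar[OF x] \<phi>.l_eq_if_tau[OF x] \<psi>.l_eq_if_tau[OF x]
      by auto
    then have "(\<phi>.l x * \<phi> g, \<psi>.l x * \<psi> g) \<in> ?W"
      using e(1) IH closed[OF IH] closed(3)[OF closed(2)[OF IH]] by (elim insertE disjE emptyE) simp_all
    then show "(\<phi> (uni_lower R x \<otimes>\<^bsub>SL2 R\<^esub> g), \<psi> (uni_lower R x \<otimes>\<^bsub>SL2 R\<^esub> g)) \<in> ?W"
      using x g by (simp add: \<phi>.rep_mult \<psi>.rep_mult)
  qed
  then show ?thesis
    by (rule signed_s3_words_trace[OF \<phi>.tau_s3_pair \<psi>.tau_s3_pair])
qed

section \<open>Truncated polynomials over the field with two elements\<close>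

lemma (in UP_cring) divide_by_indeterminate:
  assumes p: "p \<in> carrier P"
  obtains q where "q \<in> carrier P" "p = up_ring.monom P (up_ring.coeff P p 0) 0 \<oplus>\<^bsub>P\<^esub> up_ring.monom P \<one> 1 \<otimes>\<^bsub>P\<^esub> q"
proof -
  define q where "q = (\<lambda>n. up_ring.coeff P p (Suc n))"
  obtain N where N: "bound \<zero> N (up_ring.coeff P p)"
    using p by (auto simp: P_def UP_def up_def)
  have "bound \<zero> N q"
    using N by (auto simp: bound_def q_def)
  then have "q \<in> up R"
    using p by (intro mem_upI) (auto simp: q_def)
  then have q: "q \<in> carrier P" and coeff_q: "up_ring.coeff P q = q"
    unfolding P_def UP_def partial_object.simps up_ring.simps by (simp_all only: restrict_apply if_True)
  have coeff_q_eq: "up_ring.coeff P q n = up_ring.coeff P p (Suc n)" for n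
    unfolding coeff_q by (simp add: q_def)
  have x: "up_ring.monom P \<one> 1 \<in> carrier P" "up_ring.monom P (up_ring.coeff P p 0) 0 \<in> carrier P"
    using p by auto
  have "p = up_ring.monom P (up_ring.coeff P p 0) 0 \<oplus>\<^bsub>P\<^esub> up_ring.monom P \<one> 1 \<otimes>\<^bsub>P\<^esub> q"
  proof (rule up_eqI)
    fix n
    show "up_ring.coeff P p n = up_ring.coeff P (up_ring.monom P (up_ring.coeff P p 0) 0 \<oplus>\<^bsub>P\<^esub> up_ring.monom P \<one> 1 \<otimes>\<^bsub>P\<^esub> q) n"
    proof (cases n)
      case 0
      have "up_ring.coeff P (up_ring.monom P \<one> 1 \<otimes>\<^bsub>P\<^esub> q) 0 = \<zero>"
        using q by simp
      then show ?thesis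
        using p q x by (simp add: 0 del: coeff_mult)
    next
      case (Suc m)
      have "up_ring.coeff P (up_ring.monom P \<one> 1 \<otimes>\<^bsub>P\<^esub> q) (Suc m) = up_ring.coeff P p (Suc m)"
        using coeff_monom_mult[OF R.one_closed q, of 1 m] p by (simp add: coeff_q_eq del: coeff_mult)
      then show ?thesis
        using p q x by (simp add: Suc del: coeff_mult)
    qed
  qed (use p q x in auto)
  then show thesis using that q by blast
qed

text \<open>
  The element \<open>t\<close> is the class of the indeterminate. For \<open>k = 0\<close> the quotient would be the zero ring.
\<close>

lemma (in UP_cring) trunc_poly_uniserial:
  assumes R: "carrier R = {\<zero>, \<one>}" "\<one> \<noteq> \<zero>" "\<one> \<oplus> \<one> = \<zero>" and k: "k \<noteq> 0"
  obtains t where "char2_uniserial (trunc_poly_ring R k) t"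
proof -
  let ?m = "up_ring.monom P \<one> k"
  let ?I = "PIdl\<^bsub>P\<^esub> ?m"
  let ?Q = "trunc_poly_ring R k"
  have m: "?m \<in> carrier P" by (rule monom_closed) simp
  interpret I: ideal ?I P
    using P.cgenideal_ideal[OF m] .
  interpret h: ring_hom_cring P ?Q "(+>\<^bsub>P\<^esub>) ?I"
    unfolding trunc_poly_ring_def P_def[symmetric] by (rule I.rcos_ring_hom_cring) (rule P.is_cring)
  let ?h = "(+>\<^bsub>P\<^esub>) ?I"
  let ?x = "up_ring.monom P \<one> 1"
  have x: "?x \<in> carrier P" by simp
  have surj: "\<exists>p\<in>carrier P. y = ?h p" if "y \<in> carrier ?Q" for y
    using that unfolding trunc_poly_ring_def P_def[symmetric] FactRing_simps by auto
  have zero: "\<zero>\<^bsub>?Q\<^esub> = ?I"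
    unfolding trunc_poly_ring_def P_def[symmetric] FactRing_def by (simp only: ring.simps)
  have kernel: "?h p = \<zero>\<^bsub>?Q\<^esub> \<longleftrightarrow> p \<in> ?I" if "p \<in> carrier P" for p
    using that I.a_rcos_const I.rcos_const_imp_mem unfolding zero by blast
  have "\<one>\<^bsub>P\<^esub> \<oplus>\<^bsub>P\<^esub> \<one>\<^bsub>P\<^esub> = up_ring.monom P (\<one> \<oplus> \<one>) 0"
    by simp
  also have "\<one> \<oplus> \<one> = \<zero>"
    by (rule R)
  finally have two: "\<one>\<^bsub>P\<^esub> \<oplus>\<^bsub>P\<^esub> \<one>\<^bsub>P\<^esub> = \<zero>\<^bsub>P\<^esub>" by simp
  have "char2_uniserial ?Q (?h ?x)"
  proof (unfold_locales)
    show "\<one>\<^bsub>?Q\<^esub> \<oplus>\<^bsub>?Q\<^esub> \<one>\<^bsub>?Q\<^esub> = \<zero>\<^bsub>?Q\<^esub>"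
      using two h.hom_add[of "\<one>\<^bsub>P\<^esub>" "\<one>\<^bsub>P\<^esub>"] by simp
    show "\<one>\<^bsub>?Q\<^esub> \<noteq> \<zero>\<^bsub>?Q\<^esub>"
    proof
      assume "\<one>\<^bsub>?Q\<^esub> = \<zero>\<^bsub>?Q\<^esub>"
      then have "\<one>\<^bsub>P\<^esub> \<in> ?I"
        using kernel[of "\<one>\<^bsub>P\<^esub>"] by simp
      then obtain q where q: "q \<in> carrier P" "\<one>\<^bsub>P\<^esub> = q \<otimes>\<^bsub>P\<^esub> ?m"
        unfolding cgenideal_def by blast
      \<comment> \<open>A multiple of the \<open>k\<close>-th power of the indeterminate has no constant term.\<close>
      have "up_ring.coeff P (q \<otimes>\<^bsub>P\<^esub> ?m) 0 = \<zero>"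
        using q(1) k by simp
      then have "\<one> = \<zero>"
        by (simp add: coeff_one flip: q(2))
      then show False
        using R by simp
    qed
    show "?h ?x \<in> carrier ?Q" using x by simp
    have "?x [^]\<^bsub>P\<^esub> k = ?m"
      using monom_pow[of "\<one>" 1 k] by simp
    moreover have "?h ?m = \<zero>\<^bsub>?Q\<^esub>"
      using kernel[OF m] P.cgenideal_self[OF m] by simp
    ultimately show "\<exists>n::nat. ?h ?x [^]\<^bsub>?Q\<^esub> n = \<zero>\<^bsub>?Q\<^esub>"
      using h.hom_pow[OF x] by metis
    fix y assume "y \<in> carrier ?Q"
    then obtain p where p: "p \<in> carrier P" "y = ?h p" using surj by blast
    obtain q where q: "q \<in> carrier P" "p = up_ring.monom P (up_ring.coeff P p 0) 0 \<oplus>\<^bsub>P\<^esub> ?x \<otimes>\<^bsub>P\<^esub> q"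
      using divide_by_indeterminate[OF p(1)] .
    have "up_ring.coeff P p 0 \<in> carrier R" using p by simp
    then have "up_ring.coeff P p 0 = \<zero> \<or> up_ring.coeff P p 0 = \<one>"
      using R by simp
    then have "p = ?x \<otimes>\<^bsub>P\<^esub> q \<or> p = \<one>\<^bsub>P\<^esub> \<oplus>\<^bsub>P\<^esub> ?x \<otimes>\<^bsub>P\<^esub> q"
    proof
      assume "up_ring.coeff P p 0 = \<zero>"
      then show ?thesis using q x by simp
    next
      assume "up_ring.coeff P p 0 = \<one>"
      then show ?thesis using q x by simp
    qed
    then have "y = ?h ?x \<otimes>\<^bsub>?Q\<^esub> ?h q \<or> y = \<one>\<^bsub>?Q\<^esub> \<oplus>\<^bsub>?Q\<^esub> ?h ?x \<otimes>\<^bsub>?Q\<^esub> ?h q"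
      using q(1) x by (auto simp: p(2))
    then show "\<exists>r\<in>carrier ?Q. y = ?h ?x \<otimes>\<^bsub>?Q\<^esub> r \<or> y = \<one>\<^bsub>?Q\<^esub> \<oplus>\<^bsub>?Q\<^esub> ?h ?x \<otimes>\<^bsub>?Q\<^esub> r"
      using q(1) by (intro bexI[of _ "?h q"]) simp_all
  qed
  then show thesis by (rule that)
qed

section \<open>Bruhat words modulo eight\<close>

lemma odd_square_mod_8: "odd (a::int) \<Longrightarrow> 8 dvd a * a - 1"
proof -
  assume "odd a"
  then obtain m where m: "a = 2 * m + 1" by (rule oddE)
  have "a * a - 1 = 4 * (m * (m + 1))" by (simp add: m algebra_simps)
  moreover have "even (m * (m + 1))" by simp
  ultimately show ?thesis by (auto simp: dvd_def elim!: evenE)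
qed

lemma odd_column:
  assumes "8 dvd a * d - b * c - (1::int)" and "even c"
  shows "odd a"
proof
  assume "even a"
  moreover have "even (a * d - b * c - 1)"
    using assms(1) by (rule dvd_trans[rotated]) simp
  ultimately show False using assms(2) by simp
qed

text \<open>
  The image of \<open>(a, b, c, d)\<close> when \<open>U(x)\<close> goes to \<open>T x\<close>, the Weyl element \<open>W = (0, -1, 1, 0)\<close> to \<open>w\<close>
  and the diagonal matrix with entries \<open>u\<close> and \<open>1/u\<close> to the sign \<open>\<delta> u\<close>. For a unit \<open>c\<close> this is the Bruhat
  decomposition, the product of \<open>U(a/c)\<close>, \<open>W\<close>, the diagonal matrix of \<open>c\<close>, and \<open>U(d/c)\<close>. Modulo \<open>8\<close>
  every unit is its own inverse, hence the products \<open>a c\<close> and \<open>c d\<close>. If \<open>c\<close> is even, then \<open>a\<close> is odd and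
  the same formula is applied to \<open>W\<^sup>-\<^sup>1\<close> times the matrix, whose lower left entry is \<open>-a\<close>.
\<close>

definition SL2_word :: "(int \<Rightarrow> mat2) \<Rightarrow> mat2 \<Rightarrow> (int \<Rightarrow> mat2) \<Rightarrow> int \<times> int \<times> int \<times> int \<Rightarrow> mat2" where
  "SL2_word T w \<delta> = (\<lambda>(a, b, c, d).
     if odd c then \<delta> c * T (a * c) * w * T (c * d) else \<delta> (- a) * w * T (- c * a) * w * T (a * b))"

text \<open>
  The relation \<open>braid\<close> is the Bruhat decomposition of \<open>W U(x) W\<close> for a unit \<open>x\<close>. The diagonal matrix of a unit
  modulo \<open>8\<close> commutes with the unipotent matrices, as the unit has square one; this allows its image
  \<open>\<delta> x\<close> to be a sign.
\<close>

locale SL2_mod_8_relations =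
  fixes T :: "int \<Rightarrow> mat2" and w :: mat2 and \<delta> :: "int \<Rightarrow> mat2"
  assumes T_add: "T (x + y) = T x * T y" and T_8: "T 8 = 1"
    and \<delta>_sign: "\<delta> x \<in> {1, - 1}"
    and \<delta>_mod: "\<delta> (x mod 8) = \<delta> x"
    and \<delta>_mult: "odd x \<Longrightarrow> odd y \<Longrightarrow> \<delta> (x * y) = \<delta> x * \<delta> y"
    and w_square: "w * w = \<delta> (- 1)"
    and braid: "odd x \<Longrightarrow> w * T x * w = \<delta> x * (T (- x) * w * T (- x))"
begin

abbreviation "F a b c d \<equiv> SL2_word T w \<delta> (a, b, c, d)"

lemma T_0: "T 0 = 1"
  using T_add[of 0 8] by (simp add: T_8)

lemma T_inverse: "T (- x) * T x = 1"
  by (simp add: T_0 flip: T_add)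

lemma T_8_mult: "T (8 * x) = 1"
proof (induction x rule: int_induct[of _ 0])
  case base
  show ?case by (simp add: T_0)
next
  case (step1 i)
  then show ?case by (simp add: T_add T_8 distrib_left)
next
  case (step2 i)
  then have "T (8 * (i - 1)) * T 8 = 1"
    by (simp flip: T_add)
  then show ?case by (simp add: T_8)
qed

lemma T_cong: "8 dvd x - y \<Longrightarrow> T x = T y"
proof -
  assume "8 dvd x - y"
  then obtain m where "x = y + 8 * m"
    by (metis dvdE add.commute diff_add_cancel)
  then show ?thesis by (simp add: T_add T_8_mult)
qed

lemma \<delta>_cong: "8 dvd x - y \<Longrightarrow> \<delta> x = \<delta> y"
  by (metis \<delta>_mod mod_eq_dvd_iff)

lemma \<delta>_left: "w * (\<delta> x * B) = \<delta> x * (w * B)" "T y * (\<delta> x * B) = \<delta> x * (T y * B)"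
  using \<delta>_sign[of x] by auto

lemma \<delta>_square: "\<delta> x * \<delta> x = 1" "\<delta> x * (\<delta> x * A) = A"
  using \<delta>_sign[of x] by auto

lemma \<delta>_1: "\<delta> 1 = 1"
  using \<delta>_mult[of 1 1] \<delta>_sign[of 1] by auto

lemma \<delta>_minus: "odd x \<Longrightarrow> \<delta> (- x) = \<delta> (- 1) * \<delta> x"
  using \<delta>_mult[of "- 1" x] by simp

lemma w_square_left: "w * (w * A) = \<delta> (- 1) * A"
  by (simp add: w_square flip: mult.assoc)

lemma T_left: "T x * (T y * A) = T (x + y) * A"
  by (simp add: T_add mult.assoc)

lemma braid_left: "odd x \<Longrightarrow> w * (T x * (w * A)) = \<delta> x * (T (- x) * (w * (T (- x) * A)))"
  using braid[of x] by (simp add: mult.assoc[symmetric])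

lemma F_odd: "odd c \<Longrightarrow> F a b c d = \<delta> c * (T (a * c) * (w * T (c * d)))"
  by (simp add: SL2_word_def mult.assoc)

lemma F_even: "even c \<Longrightarrow> F a b c d = \<delta> (- a) * (w * (T (- c * a) * (w * T (a * b))))"
  by (simp add: SL2_word_def mult.assoc)

lemma F_cong:
  assumes "8 dvd a - a'" "8 dvd b - b'" "8 dvd c - c'" "8 dvd d - d'"
  shows "F a b c d = F a' b' c' d'"
proof -
  have mult: "8 dvd x * y - x' * y'" if "8 dvd x - x'" "8 dvd y - y'" for x x' y y' :: int
  proof -
    have "x * y - x' * y' = x * (y - y') + (x - x') * y'" by (simp add: algebra_simps)
    then show ?thesis using that by simp
  qed
  have T: "T (x * y) = T (x' * y')" if "8 dvd x - x'" "8 dvd y - y'" for x x' y y'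
    by (rule T_cong) (rule mult[OF that])
  have neg: "8 dvd - x - - x'" if "8 dvd x - x'" for x x' :: int
    using that by (metis dvd_minus_iff minus_diff_eq uminus_add_conv_diff diff_minus_eq_add add.commute)
  have "even (c - c')"
    using assms(3) by (rule dvd_trans[rotated]) simp
  then have "odd c \<longleftrightarrow> odd c'" by simp
  then show ?thesis
    using T[OF assms(1,3)] T[OF assms(3,4)] T[OF neg[OF assms(3)] assms(1)] T[OF assms(1,2)]
      \<delta>_cong[OF assms(3)] \<delta>_cong[OF neg[OF assms(1)]]
    by (simp add: SL2_word_def)
qed

text \<open>
  The word is compatible with left multiplication by \<open>W\<close>. Only the case of two odd entries in the first
  column uses the braid relation; in the other cases the definition for even \<open>c\<close> makes it immediate.
\<close>

lemma F_swap:
  assumes det: "8 dvd a * d - b * c - 1"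
  shows "F (- c) (- d) a b = w * F a b c d"
proof -
  consider "odd c" "odd a" | "odd c" "even a" | "even c" "odd a"
    using odd_column[OF det] by blast
  then show ?thesis
  proof cases
    case 1
    have "(c * d - a * c) - a * b
        = (a * d - b * c - 1) * (a * c) - (a * a - 1) * (c * d) + (c * c - 1) * (a * b)"
      by (simp add: algebra_simps)
    then have "8 dvd (c * d - a * c) - a * b"
      using det odd_square_mod_8[OF 1(1)] odd_square_mod_8[OF 1(2)] by (metis dvd_add dvd_diff dvd_mult2)
    then have "T (a * b) = T (- (a * c) + c * d)"
      by (intro T_cong[symmetric]) (simp add: algebra_simps)
    moreover have "w * F a b c d
        = \<delta> c * (\<delta> (a * c) * (T (- (a * c)) * (w * T (- (a * c) + c * d))))"
      using 1 by (simp add: F_odd \<delta>_left braid_left flip: T_add)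
    moreover have "\<delta> c * (\<delta> (a * c) * A) = \<delta> a * A" for A
      using \<delta>_mult[OF 1(2,1)] \<delta>_sign[of a] \<delta>_sign[of c] by auto
    ultimately show ?thesis
      using 1(2) by (simp add: F_odd mult.commute[of c a])
  next
    case 2
    then show ?thesis by (simp add: F_odd F_even \<delta>_left mult.commute)
  next
    case 3
    then have "w * F a b c d = \<delta> (- a) * (\<delta> (- 1) * (T (- c * a) * (w * T (a * b))))"
      by (simp add: F_even \<delta>_left w_square_left)
    also have "\<dots> = \<delta> a * (T (- c * a) * (w * T (a * b)))"
      using \<delta>_minus[OF 3(2)] \<delta>_sign[of "- 1"] \<delta>_sign[of a] by auto
    finally show ?thesis
      using 3 by (simp add: F_odd)
  qed
qed

text \<open>
  For even \<open>c\<close> the two sides are compared after multiplication by \<open>w\<close>. On the right the braid relation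
  for \<open>1\<close> produces the odd exponent \<open>-(1 + c a)\<close>, to which the braid relation applies again. The remaining
  identities between exponents hold modulo \<open>8\<close> by the determinant condition.
\<close>

lemma F_translate_1:
  assumes det: "8 dvd a * d - b * c - 1"
  shows "F (a + c) (b + d) c d = T 1 * F a b c d"
proof (cases "odd c")
  case True
  have "8 dvd (a + c) * c - (1 + a * c)"
    using odd_square_mod_8[OF True] by (simp add: algebra_simps)
  then show ?thesis
    using True by (simp add: F_odd \<delta>_left T_left T_cong)
next
  case False
  then have even: "even c" and a: "odd a"
    using odd_column[OF det] by auto
  then obtain e where e: "c = 2 * e" by (auto elim: evenE)
  let ?y = "1 + c * a"
  have y: "odd ?y" using even by simp
  have ea: "2 dvd e * (a + e)"
    using a by auto
  have e1: "8 dvd - c * (a + c) - c * a"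
  proof -
    have "- c * (a + c) - c * a = - 4 * (e * (a + e))"
      by (simp add: e algebra_simps)
    then show ?thesis using ea by (auto simp: dvd_def elim!: evenE)
  qed
  have e2: "8 dvd (a + c) * (b + d) - (?y + a * b)"
  proof -
    have "a * (e * (2 * b + d - a)) = e * (a * d - b * c - 1) - e * (a * a - 1) + 2 * b * (e * (a + e))"
      by (simp add: e algebra_simps)
    moreover have "4 dvd e * (a * d - b * c - 1)" "4 dvd e * (a * a - 1)"
      using dvd_trans[OF _ det, of 4] dvd_trans[OF _ odd_square_mod_8[OF a], of 4] by simp_all
    moreover have "4 dvd 2 * b * (e * (a + e))"
    proof -
      obtain m where "e * (a + e) = 2 * m" using ea by (rule dvdE)
      then have "2 * b * (e * (a + e)) = 4 * (b * m)" by simp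
      then show ?thesis by (rule dvdI)
    qed
    ultimately have "4 dvd a * (e * (2 * b + d - a))"
      by (metis dvd_add dvd_diff)
    moreover have "coprime 4 a"
      using a coprime_power_left_iff[of 2 2 a] by simp
    ultimately have "4 dvd e * (2 * b + d - a)"
      by (simp add: coprime_dvd_mult_right_iff)
    then have "8 dvd c * (2 * b + d - a)"
      by (auto simp: e dvd_def)
    moreover have "(a + c) * (b + d) - (?y + a * b) = (a * d - b * c - 1) + c * (2 * b + d - a)"
      by (simp add: algebra_simps)
    ultimately show ?thesis using det by (simp only: dvd_add)
  qed
  have e3: "8 dvd (a + c) - a * ?y"
  proof -
    have "(a + c) - a * ?y = - c * (a * a - 1)" by (simp add: algebra_simps)
    then show ?thesis using odd_square_mod_8[OF a] by simp
  qed
  have \<delta>_ac: "\<delta> (a + c) = \<delta> a * \<delta> ?y"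
    using \<delta>_cong[OF e3] \<delta>_mult[OF a y] by simp
  have "w * F (a + c) (b + d) c d
      = \<delta> (- (a + c)) * (\<delta> (- 1) * (T (- c * (a + c)) * (w * T ((a + c) * (b + d)))))"
    using even by (simp add: F_even \<delta>_left w_square_left)
  also have "\<dots> = \<delta> (a + c) * (T (c * a) * (w * T (?y + a * b)))"
    unfolding T_cong[OF e1] T_cong[OF e2]
    using \<delta>_minus[of "a + c"] \<delta>_sign[of "- 1"] \<delta>_sign[of "a + c"] a even by auto
  finally have "w * F (a + c) (b + d) c d = \<delta> (a + c) * (T (c * a) * (w * T (?y + a * b)))" .
  moreover have "w * (T 1 * F a b c d) = \<delta> (a + c) * (T (c * a) * (w * T (?y + a * b)))"
  proof -
    have "w * (T 1 * F a b c d) = \<delta> (- a) * (w * (T 1 * (w * (T (- c * a) * (w * T (a * b))))))"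
      using even by (simp add: F_even \<delta>_left)
    also have "\<dots> = \<delta> (- a) * (T (- 1) * (w * (T (- ?y) * (w * T (a * b)))))"
      using braid_left[of 1 "T (- c * a) * (w * T (a * b))"] by (simp add: \<delta>_1 T_left)
    also have "\<dots> = \<delta> (- a) * (\<delta> (- ?y) * (T (c * a) * (w * T (?y + a * b))))"
      using braid_left[of "- ?y" "T (a * b)"] y by (simp add: \<delta>_left T_left add.commute[of 1] flip: T_add)
    also have "\<delta> (- a) * (\<delta> (- ?y) * A) = \<delta> (a + c) * A" for A
      using \<delta>_minus[OF a] \<delta>_minus[OF y] \<delta>_ac \<delta>_sign[of "- 1"] \<delta>_sign[of a] \<delta>_sign[of ?y] by auto
    finally show ?thesis .
  qed
  ultimately have "w * (w * F (a + c) (b + d) c d) = w * (w * (T 1 * F a b c d))"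
    by simp
  then show ?thesis
    unfolding w_square_left by (metis \<delta>_square(2))
qed

lemma F_upper:
  assumes det: "8 dvd a * d - b * c - 1"
  shows "F (a + x * c) (b + x * d) c d = T x * F a b c d"
proof -
  have det': "8 dvd (a + x * c) * d - (b + x * d) * c - 1" for x
    using det by (simp add: algebra_simps)
  have step: "F (a + (x + 1) * c) (b + (x + 1) * d) c d = T 1 * F (a + x * c) (b + x * d) c d" for x
    using F_translate_1[OF det'[of x]] by (simp add: algebra_simps)
  show ?thesis
  proof (induction x rule: int_induct[of _ 0])
    case base
    show ?case by (simp add: T_0)
  next
    case (step1 i)
    then show ?case
      using step[of i] by (simp add: T_left add.commute)
  next
    case (step2 i)
    have "T 1 * F (a + (i - 1) * c) (b + (i - 1) * d) c d = T i * F a b c d"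
      using step[of "i - 1"] step2 by simp
    then have "T (- 1) * (T 1 * F (a + (i - 1) * c) (b + (i - 1) * d) c d) = T (- 1) * (T i * F a b c d)"
      by simp
    then show ?case by (simp add: T_left T_0)
  qed
qed

text \<open>
  The lower unipotent matrix \<open>L(x)\<close> is \<open>W U(-x) W\<^sup>-\<^sup>1\<close>.
\<close>

lemma F_lower:
  assumes det: "8 dvd a * d - b * c - 1"
  shows "F a b (c + x * a) (d + x * b) = \<delta> (- 1) * (w * (T (- x) * (w * F a b c d)))"
proof -
  have det1: "8 dvd c * (- b) - d * (- a) - 1"
    using det by (simp add: algebra_simps)
  have det2: "8 dvd (c + x * a) * (- b) - (d + x * b) * (- a) - 1"
    using det by (simp add: algebra_simps)
  have "F a b (c + x * a) (d + x * b) = w * F (c + x * a) (d + x * b) (- a) (- b)"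
    using F_swap[OF det2] by simp
  also have "F (c + x * a) (d + x * b) (- a) (- b) = T (- x) * F c d (- a) (- b)"
    using F_upper[OF det1, of "- x"] by simp
  also have "F c d (- a) (- b) = \<delta> (- 1) * (w * F a b c d)"
    using F_swap[OF det1] by (simp add: w_square_left \<delta>_square)
  finally show ?thesis by (simp add: \<delta>_left)
qed

lemma F_one: "F 1 0 0 1 = 1"
  by (simp add: F_even T_0 w_square \<delta>_square)

lemma F_U: "F 1 1 0 1 = T 1"
  by (simp add: F_even T_0 w_square_left \<delta>_square)

end

section \<open>Three representations over the integers modulo powers of two\<close>

locale mod_power_2 =
  fixes k :: nat and R (structure)
  assumes k: "3 \<le> k"
  defines "R \<equiv> residue_ring (2 ^ k)"

sublocale mod_power_2 < residues "2 ^ k" R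
  using k unfolding R_def by unfold_locales simp_all

sublocale mod_power_2 < cring R
  by (rule cring)

context mod_power_2
begin

lemma eight_dvd: "(8::int) dvd 2 ^ k"
  using le_imp_power_dvd[OF k, of "2::int"] by simp

lemma mod_power_2_cong: "8 dvd x mod 2 ^ k - (x::int)"
proof -
  have "2 ^ k dvd x mod 2 ^ k - x"
    by (simp add: mod_eq_dvd_iff[symmetric])
  then show ?thesis using eight_dvd dvd_trans by blast
qed

lemma SL2_determinant:
  assumes "(a, b, c, d) \<in> carrier (SL2 R)"
  shows "8 dvd a * d - b * c - 1"
proof -
  have "(a * d - b * c) mod 2 ^ k = 1"
    using assms by (simp add: SL2_carrier a_minus_def res_add_eq res_mult_eq res_neg_eq res_one_eq mod_simps)
  then show ?thesis
    using mod_power_2_cong[of "a * d - b * c"] by (metis dvd_minus_iff minus_diff_eq)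
qed

lemma odd_Units: "x \<in> carrier R \<Longrightarrow> odd x \<Longrightarrow> x \<in> Units R"
proof -
  assume x: "x \<in> carrier R" "odd x"
  then have "0 \<le> x" "x < 2 ^ k" "x \<noteq> 0"
    by (auto simp: res_carrier_eq)
  then show ?thesis using x by (simp add: res_units_eq)
qed

lemma SL2_unit_in_column:
  assumes g: "(a, b, c, d) \<in> carrier (SL2 R)"
  shows "c \<in> Units R \<or> a \<oplus> c \<in> Units R"
proof (cases "odd c")
  case False
  have cl: "a \<in> carrier R" "c \<in> carrier R"
    using g by (auto simp: SL2_carrier)
  have "odd a" using odd_column[OF SL2_determinant[OF g]] False by simp
  then have "odd ((a + c) mod 2 ^ k)"
    using False k by (simp add: dvd_mod_iff)
  then show ?thesis
    using odd_Units[of "a \<oplus> c"] cl cl by (simp add: res_add_eq)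
qed (use g odd_Units in \<open>auto simp: SL2_carrier\<close>)

text \<open>
  Multiplicativity for an elementary left factor is the content of \<open>F_upper\<close> and \<open>F_lower\<close>, and elementary
  matrices generate the group.
\<close>

lemma SL2_word_rep:
  assumes "SL2_mod_8_relations T w \<delta>"
  shows "rep2 (SL2 R) (SL2_word T w \<delta>)"
proof -
  interpret SL2_mod_8_relations T w \<delta> by (rule assms)
  interpret S: group "SL2 R" by (rule SL2_group)
  let ?F = "SL2_word T w \<delta>"
  have one: "?F \<one>\<^bsub>SL2 R\<^esub> = 1"
    using F_one by (simp add: SL2_one res_one_eq res_zero_eq)
  have up: "?F (uni_upper R x \<otimes>\<^bsub>SL2 R\<^esub> g) = T x * ?F g"
    and low: "?F (uni_lower R x \<otimes>\<^bsub>SL2 R\<^esub> g) = \<delta> (- 1) * (w * (T (- x) * (w * ?F g)))"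
    if g: "g \<in> carrier (SL2 R)" for x g
  proof -
    obtain a b c d where ge: "g = (a, b, c, d)" by (cases g)
    have det: "8 dvd a * d - b * c - 1"
      using SL2_determinant g ge by blast
    have "?F (uni_upper R x \<otimes>\<^bsub>SL2 R\<^esub> g) = ?F (a + x * c, b + x * d, c, d)"
      unfolding ge uni_upper_def SL2_mult res_add_eq res_mult_eq res_one_eq res_zero_eq mod_simps
      by (intro F_cong) (use mod_power_2_cong in simp_all)
    then show "?F (uni_upper R x \<otimes>\<^bsub>SL2 R\<^esub> g) = T x * ?F g"
      using F_upper[OF det] by (simp add: ge)
    have "?F (uni_lower R x \<otimes>\<^bsub>SL2 R\<^esub> g) = ?F (a, b, c + x * a, d + x * b)"
      unfolding ge uni_lower_def SL2_mult res_add_eq res_mult_eq res_one_eq res_zero_eq mod_simps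
      by (intro F_cong) (use mod_power_2_cong in \<open>simp_all add: add.commute\<close>)
    then show "?F (uni_lower R x \<otimes>\<^bsub>SL2 R\<^esub> g) = \<delta> (- 1) * (w * (T (- x) * (w * ?F g)))"
      using F_lower[OF det] by (simp add: ge)
  qed
  have "?F (g \<otimes>\<^bsub>SL2 R\<^esub> h) = ?F g * ?F h" if g: "g \<in> carrier (SL2 R)" and h: "h \<in> carrier (SL2 R)" for g h
    using g SL2_unit_in_column
  proof (rule SL2_elementary_induct)
    show "?F (\<one>\<^bsub>SL2 R\<^esub> \<otimes>\<^bsub>SL2 R\<^esub> h) = ?F \<one>\<^bsub>SL2 R\<^esub> * ?F h"
      using h one by simp
  next
    fix x g assume x: "x \<in> carrier R" and g: "g \<in> carrier (SL2 R)"
      and IH: "?F (g \<otimes>\<^bsub>SL2 R\<^esub> h) = ?F g * ?F h"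
    show "?F (uni_upper R x \<otimes>\<^bsub>SL2 R\<^esub> g \<otimes>\<^bsub>SL2 R\<^esub> h) = ?F (uni_upper R x \<otimes>\<^bsub>SL2 R\<^esub> g) * ?F h"
      "?F (uni_lower R x \<otimes>\<^bsub>SL2 R\<^esub> g \<otimes>\<^bsub>SL2 R\<^esub> h) = ?F (uni_lower R x \<otimes>\<^bsub>SL2 R\<^esub> g) * ?F h"
      using x g h by (simp_all add: S.m_assoc up low IH mult.assoc)
  qed
  then show ?thesis
    by (simp add: rep2_def one)
qed

lemma SL2_word_value:
  assumes "SL2_mod_8_relations T w \<delta>"
  shows "SL2_word T w \<delta> (uni_upper R \<one>) = T 1"
  using SL2_mod_8_relations.F_U[OF assms] by (simp add: uni_upper_def res_one_eq res_zero_eq)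

lemma SL2_word_noncommuting:
  assumes rel: "SL2_mod_8_relations T w \<delta>" and comm: "T 1 * w \<noteq> w * T 1"
  shows "\<not> commuting_on (carrier (SL2 R)) (SL2_word T w \<delta>)"
proof
  assume "commuting_on (carrier (SL2 R)) (SL2_word T w \<delta>)"
  moreover have "uni_upper R \<one> \<in> carrier (SL2 R)" "uni_lower R \<one> \<in> carrier (SL2 R)"
    by simp_all
  moreover have "SL2_word T w \<delta> (uni_lower R \<one>) = T 1 * w * T 1"
    using SL2_mod_8_relations.\<delta>_1[OF rel]
    by (simp add: uni_lower_def res_one_eq res_zero_eq SL2_word_def)
  ultimately have "T 1 * (T 1 * w * T 1) = T 1 * w * T 1 * T 1"
    using SL2_word_value[OF rel] unfolding commuting_on_def by metis
  then have "T (- 1) * (T 1 * (T 1 * w * T 1)) * T (- 1) = T (- 1) * (T 1 * w * T 1 * T 1) * T (- 1)"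
    by simp
  moreover have "T (- 1) * (T 1 * (T 1 * w * T 1)) * T (- 1) = (T (- 1) * T 1) * (T 1 * w) * (T 1 * T (- 1))"
    "T (- 1) * (T 1 * w * T 1 * T 1) * T (- 1) = (T (- 1) * T 1) * (w * T 1) * (T 1 * T (- 1))"
    by (simp_all only: mult.assoc)
  moreover have "T (- 1) * T 1 = 1" "T 1 * T (- 1) = 1"
    using SL2_mod_8_relations.T_inverse[OF rel, of 1] SL2_mod_8_relations.T_inverse[OF rel, of "- 1"]
    by simp_all
  ultimately show False using comm by simp
qed

lemma finite_SL2: "finite (carrier (SL2 R))"
proof (rule finite_subset)
  show "carrier (SL2 R) \<subseteq> carrier R \<times> carrier R \<times> carrier R \<times> carrier R"
    by (auto simp: SL2_def)
qed simp

end

text \<open>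
  A primitive eighth root of unity.
\<close>

definition \<zeta> :: complex where "\<zeta> = Complex (sqrt 2 / 2) (sqrt 2 / 2)"

text \<open>
  The matrices \<open>oct_T 1\<close> and \<open>oct_w\<close> generate the binary octahedral group inside the unitary matrices of
  determinant one.
\<close>

definition oct_T :: "int \<Rightarrow> mat2" where
  "oct_T x = Mat2 (\<zeta> powi (- x)) 0 0 (\<zeta> powi x)"

definition oct_w :: mat2 where
  "oct_w = (let s = Complex 0 (sqrt 2 / 2) in Mat2 s s s (- s))"

text \<open>
  For odd \<open>x\<close> this is the Jacobi symbol of \<open>-2\<close> over \<open>x\<close>.
\<close>

definition oct_sign :: "int \<Rightarrow> mat2" where
  "oct_sign x = (if x mod 8 \<in> {1, 3} then 1 else - 1)"

lemma zeta_powers: "\<zeta> ^ 2 = \<i>" "\<zeta> ^ 3 = Complex (- sqrt 2 / 2) (sqrt 2 / 2)" "\<zeta> ^ 4 = - 1"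
  "\<zeta> ^ 5 = - \<zeta>" "\<zeta> ^ 7 = Complex (sqrt 2 / 2) (- sqrt 2 / 2)" "\<zeta> ^ 8 = 1" "\<zeta> \<noteq> 0"
proof -
  show 2: "\<zeta> ^ 2 = \<i>"
    by (simp add: \<zeta>_def power2_eq_square complex_eq_iff)
  have "\<zeta> ^ 3 = \<zeta> ^ 2 * \<zeta>" "\<zeta> ^ 4 = \<zeta> ^ 2 * \<zeta> ^ 2" "\<zeta> ^ 5 = \<zeta> ^ 2 * \<zeta> ^ 2 * \<zeta>"
    "\<zeta> ^ 7 = \<zeta> ^ 2 * \<zeta> ^ 2 * \<zeta> ^ 2 * \<zeta>" "\<zeta> ^ 8 = \<zeta> ^ 2 * \<zeta> ^ 2 * \<zeta> ^ 2 * \<zeta> ^ 2"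
    by (simp_all flip: power_add power_Suc power_Suc2)
  then show "\<zeta> ^ 3 = Complex (- sqrt 2 / 2) (sqrt 2 / 2)" "\<zeta> ^ 4 = - 1" "\<zeta> ^ 5 = - \<zeta>"
    "\<zeta> ^ 7 = Complex (sqrt 2 / 2) (- sqrt 2 / 2)" "\<zeta> ^ 8 = 1"
    unfolding 2 by (simp_all add: \<zeta>_def complex_eq_iff)
  show "\<zeta> \<noteq> 0"
    by (simp add: \<zeta>_def complex_eq_iff)
qed

lemma zeta_powi_mod: "\<zeta> powi x = \<zeta> ^ nat (x mod 8)"
proof -
  have "\<zeta> powi x = \<zeta> powi (8 * (x div 8) + x mod 8)" by simp
  also have "\<dots> = (\<zeta> powi 8) powi (x div 8) * \<zeta> powi (x mod 8)"
    using zeta_powers(7) by (subst power_int_add) (auto simp: power_int_mult)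
  also have "\<dots> = \<zeta> ^ nat (x mod 8)"
    using zeta_powers(6) by (simp add: power_int_def)
  finally show ?thesis .
qed

lemma odd_mod_8_cases:
  assumes "odd (x::int)"
  obtains "x mod 8 = 1" | "x mod 8 = 3" | "x mod 8 = 5" | "x mod 8 = 7"
proof -
  have "x mod 8 \<in> {1, 3, 5, 7}" using assms by simp presburger
  then show thesis using that by auto
qed

lemma minus_mod_8: "x mod 8 = (1::int) \<Longrightarrow> (- x) mod 8 = 7" "x mod 8 = (3::int) \<Longrightarrow> (- x) mod 8 = 5"
  "x mod 8 = (5::int) \<Longrightarrow> (- x) mod 8 = 3" "x mod 8 = (7::int) \<Longrightarrow> (- x) mod 8 = 1"
  by presburger+

lemma oct_T_odd:
  defines "r \<equiv> sqrt 2 / 2"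
  shows "x mod 8 = 1 \<Longrightarrow> oct_T x = Mat2 (Complex r (- r)) 0 0 (Complex r r)"
    and "x mod 8 = 3 \<Longrightarrow> oct_T x = Mat2 (Complex (- r) (- r)) 0 0 (Complex (- r) r)"
    and "x mod 8 = 5 \<Longrightarrow> oct_T x = Mat2 (Complex (- r) r) 0 0 (Complex (- r) (- r))"
    and "x mod 8 = 7 \<Longrightarrow> oct_T x = Mat2 (Complex r r) 0 0 (Complex r (- r))"
proof -
  have "\<zeta> = Complex r r" "- \<zeta> = Complex (- r) (- r)"
    by (simp_all add: \<zeta>_def r_def complex_eq_iff)
  then show "x mod 8 = 1 \<Longrightarrow> oct_T x = Mat2 (Complex r (- r)) 0 0 (Complex r r)"
    "x mod 8 = 3 \<Longrightarrow> oct_T x = Mat2 (Complex (- r) (- r)) 0 0 (Complex (- r) r)"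
    "x mod 8 = 5 \<Longrightarrow> oct_T x = Mat2 (Complex (- r) r) 0 0 (Complex (- r) (- r))"
    "x mod 8 = 7 \<Longrightarrow> oct_T x = Mat2 (Complex r r) 0 0 (Complex r (- r))"
    unfolding oct_T_def zeta_powi_mod by (simp_all add: minus_mod_8 zeta_powers r_def)
qed

lemma oct_sign_mult:
  assumes "odd x" and "odd y"
  shows "oct_sign (x * y) = oct_sign x * oct_sign y"
proof -
  have "(x * y) mod 8 = ((x mod 8) * (y mod 8)) mod 8" by (simp add: mod_mult_eq)
  then show ?thesis
    by (cases rule: odd_mod_8_cases[OF assms(1)]; cases rule: odd_mod_8_cases[OF assms(2)])
       (simp_all add: oct_sign_def)
qed

lemma oct_relations: "SL2_mod_8_relations oct_T oct_w oct_sign"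
proof
  show "oct_T (x + y) = oct_T x * oct_T y" for x y
    using zeta_powers(7) by (simp add: oct_T_def power_int_add power_int_diff power_int_minus divide_simps)
  show "oct_T 8 = 1"
    by (simp add: oct_T_def power_int_minus zeta_powers one_mat2_def)
  show "oct_sign x \<in> {1, - 1}" "oct_sign (x mod 8) = oct_sign x" for x
    by (simp_all add: oct_sign_def)
  show "oct_sign (x * y) = oct_sign x * oct_sign y" if "odd x" "odd y" for x y
    using oct_sign_mult that .
  show "oct_w * oct_w = oct_sign (- 1)"
    by (simp add: oct_w_def oct_sign_def one_mat2_def complex_eq_iff Let_def)
  show "oct_w * oct_T x * oct_w = oct_sign x * (oct_T (- x) * oct_w * oct_T (- x))" if "odd x" for x
    using odd_mod_8_cases[OF that]
    by cases (simp_all add: oct_T_odd[of x] oct_T_odd[of "- x"] minus_mod_8 oct_w_def Let_def oct_sign_def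
        complex_eq_iff)
qed

text \<open>
  The second representation of degree two arises from the first by the Galois automorphism
  \<open>\<zeta> \<mapsto> \<zeta>\<^sup>3\<close>, which fixes \<open>oct_w\<close> because it changes the sign of both \<open>\<i>\<close> and \<open>\<surd>2\<close>.
\<close>

lemma oct3_relations: "SL2_mod_8_relations (\<lambda>x. oct_T (3 * x)) oct_w oct_sign"
proof -
  interpret SL2_mod_8_relations oct_T oct_w oct_sign by (rule oct_relations)
  have "oct_sign 3 = 1" by (simp add: oct_sign_def)
  then have "oct_sign (3 * x) = oct_sign x" if "odd x" for x
    using oct_sign_mult[of 3 x] that by simp
  then show ?thesis
    using T_8_mult[of 3] \<delta>_sign \<delta>_mod \<delta>_mult w_square braid
    by unfold_locales (simp_all add: T_add distrib_left)
qed

text \<open>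
  The third representation factors through reduction modulo \<open>2\<close>, onto a group isomorphic to the
  symmetric group on three letters.
\<close>

definition s3_T :: "int \<Rightarrow> mat2" where
  "s3_T x = Mat2 1 0 0 (if even x then 1 else - 1)"

definition s3_w :: mat2 where
  "s3_w = Mat2 (- 1 / 2) 1 (3 / 4) (1 / 2)"

lemma s3_relations: "SL2_mod_8_relations s3_T s3_w (\<lambda>_. 1)"
  by unfold_locales (simp_all add: s3_T_def s3_w_def one_mat2_def)

lemma traces_at_generator:
  "tr (oct_T 1) = of_real (sqrt 2)" "tr (oct_T (3 * 1)) = - of_real (sqrt 2)" "tr (s3_T 1) = 0"
  by (simp_all add: oct_T_odd s3_T_def complex_eq_iff)

lemma noncommuting_at_generator:
  "oct_T 1 * oct_w \<noteq> oct_w * oct_T 1" "oct_T (3 * 1) * oct_w \<noteq> oct_w * oct_T (3 * 1)"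
  "s3_T 1 * s3_w \<noteq> s3_w * s3_T 1"
  by (simp_all add: oct_T_odd s3_T_def s3_w_def oct_w_def Let_def complex_eq_iff)

section \<open>The group algebras are not isomorphic\<close>

theorem proposition1:
  fixes k :: nat
  assumes "3 \<le> k" and "k \<le> 8"
  shows "\<not> group_algebra (SL2 (trunc_poly_ring (residue_ring 2) k))
           \<cong>\<^sub>\<complex> group_algebra (SL2 (residue_ring (2 ^ k)))"
proof
  let ?R = "residue_ring (2 ^ k)" and ?Q = "trunc_poly_ring (residue_ring 2) k"
  let ?G = "SL2 ?R" and ?H = "SL2 ?Q"
  assume "group_algebra ?H \<cong>\<^sub>\<complex> group_algebra ?G"
  then obtain h where h: "h \<in> complex_alg_iso (group_algebra ?H) (group_algebra ?G)"
    unfolding is_complex_alg_iso_def by blast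
  have "residues 2" by unfold_locales simp
  then have UP: "UP_cring (residue_ring 2)"
    by (intro UP_cring.intro residues.cring)
  have F2: "carrier (residue_ring 2) = {\<zero>\<^bsub>residue_ring 2\<^esub>, \<one>\<^bsub>residue_ring 2\<^esub>}"
    "\<one>\<^bsub>residue_ring 2\<^esub> \<noteq> \<zero>\<^bsub>residue_ring 2\<^esub>"
    "\<one>\<^bsub>residue_ring 2\<^esub> \<oplus>\<^bsub>residue_ring 2\<^esub> \<one>\<^bsub>residue_ring 2\<^esub> = \<zero>\<^bsub>residue_ring 2\<^esub>"
    by (auto simp: residue_ring_def)
  have "k \<noteq> 0" using assms by simp
  then obtain t where t: "char2_uniserial ?Q t"
    using UP_cring.trunc_poly_uniserial[OF UP F2] by metis
  interpret H: char2_uniserial ?Q t by (rule t)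
  interpret G: mod_power_2 k ?R by unfold_locales (rule assms)
  note pull = G.SL2_group H.SL2_group G.finite_SL2 H.finite_SL2 h
  define \<rho>\<^sub>1 where "\<rho>\<^sub>1 = SL2_word oct_T oct_w oct_sign"
  define \<rho>\<^sub>2 where "\<rho>\<^sub>2 = SL2_word (\<lambda>x. oct_T (3 * x)) oct_w oct_sign"
  define \<rho>\<^sub>3 where "\<rho>\<^sub>3 = SL2_word s3_T s3_w (\<lambda>_. 1)"
  let ?reps = "{\<rho>\<^sub>1, \<rho>\<^sub>2, \<rho>\<^sub>3}"
  let ?g = "uni_upper ?R \<one>\<^bsub>?R\<^esub>"
  have g: "?g \<in> carrier ?G" by simp
  have traces: "tr (\<rho>\<^sub>1 ?g) = of_real (sqrt 2)" "tr (\<rho>\<^sub>2 ?g) = - of_real (sqrt 2)" "tr (\<rho>\<^sub>3 ?g) = 0"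
    unfolding \<rho>\<^sub>1_def \<rho>\<^sub>2_def \<rho>\<^sub>3_def
    by (simp_all only: G.SL2_word_value oct_relations oct3_relations s3_relations traces_at_generator)
  have pulled: "noncommuting_rep ?Q t (pullback_rep ?G h \<rho>)" if "\<rho> \<in> ?reps" for \<rho>
  proof -
    have "rep2 ?G \<rho>"
      using that G.SL2_word_rep oct_relations oct3_relations s3_relations
      by (auto simp: \<rho>\<^sub>1_def \<rho>\<^sub>2_def \<rho>\<^sub>3_def)
    moreover have "\<not> commuting_on (carrier ?G) \<rho>"
      using that G.SL2_word_noncommuting oct_relations oct3_relations s3_relations
        noncommuting_at_generator
      by (auto simp: \<rho>\<^sub>1_def \<rho>\<^sub>2_def \<rho>\<^sub>3_def)
    ultimately show ?thesis
      using rep2_pullback[OF pull] pullback_commuting[OF pull]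
      by (intro noncommuting_rep.intro noncommuting_rep_axioms.intro t) auto
  qed
  let ?s = "\<lambda>\<rho>. pullback_rep ?G h \<rho> (uni_upper ?Q t)"
  have signs: "?s \<rho> \<in> {1, - 1}" if "\<rho> \<in> ?reps" for \<rho>
    using noncommuting_rep.u_t_scalar[OF pulled[OF that]] .
  have separated: "tr (\<rho> ?g) = tr (\<rho>' ?g)" if "\<rho> \<in> ?reps" "\<rho>' \<in> ?reps" "?s \<rho> = ?s \<rho>'" for \<rho> \<rho>'
    using pullback_character[OF pull _ g] H.character_determined[OF pulled pulled] that by blast
  \<comment> \<open>Three representations share two possible signs.\<close>
  have "?s \<rho>\<^sub>1 = ?s \<rho>\<^sub>2 \<or> ?s \<rho>\<^sub>1 = ?s \<rho>\<^sub>3 \<or> ?s \<rho>\<^sub>2 = ?s \<rho>\<^sub>3"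
    using signs[of \<rho>\<^sub>1] signs[of \<rho>\<^sub>2] signs[of \<rho>\<^sub>3] by auto
  then show False
    using separated[of \<rho>\<^sub>1 \<rho>\<^sub>2] separated[of \<rho>\<^sub>1 \<rho>\<^sub>3] separated[of \<rho>\<^sub>2 \<rho>\<^sub>3] by (auto simp: traces)
qed

end
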